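(* Let $r>0$, let $X$ be a complete Hausdorff locally convex space and $(T(t))_{t\geq 0}$ a strongly continuous quasi-equicontinuous semigroup on $X$ with generator $A$ such that $0\in\rho(A)$. Consider the following assertions. (a) $(T(t))_{t\geq 0}$ satisfies $\mathrm{C}$-maximal regularity for $r$. (b) $A_{-1}$ is $\mathrm{C}$-admissible for $r$. (c) $(T(t))_{t\in [0,r]}$ is of bounded semivariation. Then (c)$\Rightarrow$(a)$\Rightarrow$(b). If $X$ is a $3\mathrm{C}_{A,r}$-space, then (b)$\Rightarrow$(c).
   Context: All spaces are over $\mathbb{K}=\mathbb{R}$ or $\mathbb{C}$. For a Hausdorff locally convex space $X$, $\Gamma_X$ denotes a fundamental system of seminorms (a family of continuous seminorms such that every continuous seminorm $q$ on $X$ satisfies $q\le Cp$ for some $p\in\Gamma_X$, $C\ge 0$). $\mathcal{L}(X;Y)$ is the space of continuous linear maps, $\mathcal{L}(X)=\mathcal{L}(X;X)$. $\mathrm{C}([0,r];X)$ is the space of continuous functions $[0,r]\to X$ with the seminorms $\|f\|_p=\sup_{s\in[0,r]}p(f(s))$, $p\in\Gamma_X$. A family $(T(t))_{t\ge0}$ in $\mathcal{L}(X)$ is a semigroup if $T(0)=\mathrm{id}$ and $T(t+s)=T(t)T(s)$; strongly continuous if $t\mapsto T(t)x$ is continuous on $[0,\infty)$ for all $x\in X$; quasi-equicontinuous if there is $\omega\in\mathbb{R}$ such that for all $q\in\Gamma_X$ there are $p\in\Gamma_X$, $C\ge0$ with $q(e^{-\omega t}T(t)x)\le Cp(x)$ for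 all $t\ge0$, $x\in X$. Its generator is $Ax=\lim_{t\to0+}\frac{T(t)x-x}{t}$ with domain $D(A)$ the set of $x\in X$ for which this limit exists. $\rho(A)$ is the set of $\lambda\in\mathbb{C}$ such that $\lambda-A\colon D(A)\to X$ is bijective with $(\lambda-A)^{-1}\in\mathcal{L}(X)$. Extrapolation space (for $0\in\rho(A)$): $(X_{-1},\tau_{-1})$ is the completion of $X$ with respect to the seminorms $x\mapsto p(A^{-1}x)$, $p\in\Gamma_X$. Each $T(t)$ extends uniquely to a continuous linear $T_{-1}(t)$ on $X_{-1}$, and $(T_{-1}(t))_{t\ge0}$ is a strongly continuous quasi-equicontinuous semigroup on $X_{-1}$ with generator $A_{-1}$, $D(A_{-1})=X$; $A_{-1}\colon X\to X_{-1}$ is a topological isomorphism extending $A$ and $T_{-1}(t)=A_{-1}T(t)A_{-1}^{-1}$ (known facts). For $g\in\mathrm{C}([0,r];X)$, $(T\ast g)(t)=\int_0^tT(t-s)g(s)\,\mathrm{d}s$ (Riemann integral in $X$); analogously for $T_{-1}$ with Riemann integrals in $X_{-1}$. $\mathrm{C}$-maximal regularity for $r$: for all $f\in\mathrm{C}([0,r];X)$ one has $(T\ast f)(t)\in D(A)$ for all $t\in[0,r]$ and $A(T\ast f)\in\mathrm{C}([0,r];X)$. $A_{-1}\in\mathcal{L}(X;X_{-1})$ is $\mathrm{C}$-admissible for $r$ if $(T_{-1}\ast A_{-1}f)(r)=\int_0^rT_{-1}(r-s)A_{-1}f(s)\,\mathrm{d}s$ (Riemann integral in $X_{-1}$) belongs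 to $X$ for all $f\in\mathrm{C}([0,r];X)$. For $\alpha\colon[0,r]\to\mathcal{L}(X)$ and $q,p\in\Gamma_X$, let $SV_{q,p}(\alpha)$ be the supremum of $q\bigl(\sum_{i=1}^n(\alpha(d_i)-\alpha(d_{i-1}))x_i\bigr)$ over all partitions $0=d_0<\dots<d_n=r$ and all $x_i\in X$ with $p(x_i)\le1$. $(T(t))_{t\in[0,r]}$ is of bounded semivariation if for every $q\in\Gamma_X$ there is $p\in\Gamma_X$ with $SV_{q,p}(T(\cdot))<\infty$. $3\mathrm{C}_{A,r}$-space: suppose $\Psi_r(f):=(T\ast f)(r)\in D(A)$ for all $f\in\mathrm{C}([0,r];X)$. Then $X$ is called a $3\mathrm{C}_{A,r}$-space if the (closed) linear map $A\Psi_r\colon\mathrm{C}([0,r];X)\to X$ is continuous. *)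

theory Defs
  imports "HOL-Analysis.Analysis" "HOL-Library.Function_Algebras"
begin

text \<open>
  The scalar field is a type \<open>'k::real_normed_field\<close>. As the norm of such a field is
  multiplicative, it is isometrically isomorphic to the reals or to the complex numbers
  (Gelfand--Mazur), so this covers exactly the two cases \<open>K = R\<close> and \<open>K = C\<close>.
  Real scalars such as \<open>1/t\<close> enter through \<^const>\<open>of_real\<close>.

  Locally convex spaces are types whose group topology is given by type classes, with the scalar
  multiplication as an explicit parameter. In the class \<^class>\<open>uniform_topological_group_add\<close> the
  uniformity is the one induced by the group topology, so that completeness
  (\<^class>\<open>complete_uniform_space\<close>) is completeness as a topological vector space.
\<close>

definition seminorm :: "('k::real_normed_field \<Rightarrow> 'a::ab_group_add \<Rightarrow> 'a) \<Rightarrow> ('a \<Rightarrow> real) \<Rightarrow> bool" where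
  "seminorm sc p \<longleftrightarrow>
     (\<forall>x y. p (x + y) \<le> p x + p y) \<and> (\<forall>c x. p (sc c x) = norm c * p x)"

text \<open>The topology on \<open>V\<close> generated by a family \<open>P\<close> of seminorms, which need not be directed.\<close>

definition seminorm_topology :: "'v::minus set \<Rightarrow> ('v \<Rightarrow> real) set \<Rightarrow> 'v topology" where
  "seminorm_topology V P = topology (\<lambda>U. U \<subseteq> V \<and>
     (\<forall>x\<in>U. \<exists>F e. finite F \<and> F \<subseteq> P \<and> e > 0 \<and> {y \<in> V. \<forall>p\<in>F. p (y - x) < e} \<subseteq> U))"

lemma openin_seminorm_topology:
  "openin (seminorm_topology V P) U \<longleftrightarrow> U \<subseteq> V \<and>
     (\<forall>x\<in>U. \<exists>F e. finite F \<and> F \<subseteq> P \<and> e > 0 \<and> {y \<in> V. \<forall>p\<in>F. p (y - x) < e} \<subseteq> U)"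
  (is "_ \<longleftrightarrow> ?O U")
proof -
  have mono: "?O S \<Longrightarrow> x \<in> S \<Longrightarrow> S \<subseteq> W \<Longrightarrow>
      \<exists>F e. finite F \<and> F \<subseteq> P \<and> e > 0 \<and> {y \<in> V. \<forall>p\<in>F. p (y - x) < e} \<subseteq> W" for S W x
    by (meson subset_trans)
  have int: "?O (S \<inter> T)" if S: "?O S" and T: "?O T" for S T
  proof (intro conjI ballI)
    show "S \<inter> T \<subseteq> V" using conjunct1[OF S] by (rule le_infI1)
    fix x assume x: "x \<in> S \<inter> T"
    obtain F e where 1: "finite F" "F \<subseteq> P" "e > 0" "{y \<in> V. \<forall>p\<in>F. p (y - x) < e} \<subseteq> S"
      using bspec[OF conjunct2[OF S] IntD1[OF x]] by (elim exE conjE)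
    obtain G d where 2: "finite G" "G \<subseteq> P" "d > 0" "{y \<in> V. \<forall>p\<in>G. p (y - x) < d} \<subseteq> T"
      using bspec[OF conjunct2[OF T] IntD2[OF x]] by (elim exE conjE)
    have "{y \<in> V. \<forall>p\<in>F \<union> G. p (y - x) < min e d} \<subseteq>
        {y \<in> V. \<forall>p\<in>F. p (y - x) < e} \<inter> {y \<in> V. \<forall>p\<in>G. p (y - x) < d}"
      by (simp add: subset_iff)
    then have "{y \<in> V. \<forall>p\<in>F \<union> G. p (y - x) < min e d} \<subseteq> S \<inter> T"
      using Int_mono[OF 1(4) 2(4)] by (rule subset_trans)
    then show "\<exists>F e. finite F \<and> F \<subseteq> P \<and> e > 0 \<and> {y \<in> V. \<forall>p\<in>F. p (y - x) < e} \<subseteq> S \<inter> T"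
      using 1 2 by (intro exI[of _ "F \<union> G"] exI[of _ "min e d"]) simp
  qed
  have un: "?O (\<Union>\<K>)" if K: "\<forall>U\<in>\<K>. ?O U" for \<K>
  proof (intro conjI ballI)
    show "\<Union>\<K> \<subseteq> V" using K by (simp add: Sup_le_iff)
    fix x assume "x \<in> \<Union>\<K>"
    then obtain U where U: "U \<in> \<K>" "x \<in> U" by (rule UnionE)
    show "\<exists>F e. finite F \<and> F \<subseteq> P \<and> e > 0 \<and> {y \<in> V. \<forall>p\<in>F. p (y - x) < e} \<subseteq> \<Union>\<K>"
      by (rule mono[OF bspec[OF K U(1)] U(2) Union_upper[OF U(1)]])
  qed
  have "istopology ?O"
    unfolding istopology_def by (rule conjI; intro allI impI; (rule int un, assumption+))
  then show ?thesis
    unfolding seminorm_topology_def by (simp only: topology_inverse')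
qed

definition locally_convex_space ::
    "('k::real_normed_field \<Rightarrow> 'a::{topological_space, ab_group_add} \<Rightarrow> 'a) \<Rightarrow> bool" where
  "locally_convex_space sc \<longleftrightarrow> vector_space sc \<and>
     (euclidean :: 'a topology) = seminorm_topology UNIV {p. seminorm sc p \<and> continuous_on UNIV p}"

definition fundamental_system ::
    "('k::real_normed_field \<Rightarrow> 'a::{topological_space, ab_group_add} \<Rightarrow> 'a) \<Rightarrow> ('a \<Rightarrow> real) set \<Rightarrow> bool"
  where
  "fundamental_system sc \<Gamma> \<longleftrightarrow>
     (\<forall>p\<in>\<Gamma>. seminorm sc p \<and> continuous_on UNIV p) \<and>
     (\<forall>q. seminorm sc q \<and> continuous_on UNIV q \<longrightarrow> (\<exists>p\<in>\<Gamma>. \<exists>C\<ge>0. \<forall>x. q x \<le> C * p x))"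

definition continuous_linear ::
    "('k::field \<Rightarrow> 'a::{topological_space, ab_group_add} \<Rightarrow> 'a) \<Rightarrow>
     ('k \<Rightarrow> 'b::{topological_space, ab_group_add} \<Rightarrow> 'b) \<Rightarrow> ('a \<Rightarrow> 'b) \<Rightarrow> bool" where
  "continuous_linear sc1 sc2 S \<longleftrightarrow>
     Vector_Spaces.linear sc1 sc2 S \<and> continuous_on UNIV S"


subsection \<open>Semigroups and generators\<close>

text \<open>A semigroup is a function on \<open>real\<close> of which only the values at \<open>t \<ge> 0\<close> matter.\<close>

definition strongly_continuous_semigroup ::
    "('k::field \<Rightarrow> 'a::{topological_space, ab_group_add} \<Rightarrow> 'a) \<Rightarrow> (real \<Rightarrow> 'a \<Rightarrow> 'a) \<Rightarrow> bool" where
  "strongly_continuous_semigroup sc T \<longleftrightarrow>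
     (\<forall>t\<ge>0. continuous_linear sc sc (T t)) \<and>
     T 0 = id \<and> (\<forall>t\<ge>0. \<forall>s\<ge>0. T (t + s) = T t \<circ> T s) \<and>
     (\<forall>x. continuous_on {0..} (\<lambda>t. T t x))"

definition quasi_equicontinuous ::
    "('k::real_normed_field \<Rightarrow> 'a::ab_group_add \<Rightarrow> 'a) \<Rightarrow> ('a \<Rightarrow> real) set \<Rightarrow>
     (real \<Rightarrow> 'a \<Rightarrow> 'a) \<Rightarrow> bool" where
  "quasi_equicontinuous sc \<Gamma> T \<longleftrightarrow>
     (\<exists>\<omega>::real. \<forall>q\<in>\<Gamma>. \<exists>p\<in>\<Gamma>. \<exists>C\<ge>0. \<forall>t\<ge>0. \<forall>x.
        q (sc (of_real (exp (- \<omega> * t))) (T t x)) \<le> C * p x)"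

definition generator_domain ::
    "('k::real_normed_field \<Rightarrow> 'a::{topological_space, ab_group_add} \<Rightarrow> 'a) \<Rightarrow>
     (real \<Rightarrow> 'a \<Rightarrow> 'a) \<Rightarrow> 'a set" where
  "generator_domain sc T =
     {x. \<exists>y. ((\<lambda>t. sc (of_real (1 / t)) (T t x - x)) \<longlongrightarrow> y) (at_right 0)}"

definition generator ::
    "('k::real_normed_field \<Rightarrow> 'a::{t2_space, ab_group_add} \<Rightarrow> 'a) \<Rightarrow>
     (real \<Rightarrow> 'a \<Rightarrow> 'a) \<Rightarrow> 'a \<Rightarrow> 'a" where
  "generator sc T x = Lim (at_right 0) (\<lambda>t. sc (of_real (1 / t)) (T t x - x))"

text \<open>The part of the resolvent set in the scalar field of the space.\<close>

definition resolvent_set ::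
    "('k::field \<Rightarrow> 'a::{topological_space, ab_group_add} \<Rightarrow> 'a) \<Rightarrow> 'a set \<Rightarrow> ('a \<Rightarrow> 'a) \<Rightarrow> 'k set"
  where
  "resolvent_set sc D A =
     {l. bij_betw (\<lambda>x. sc l x - A x) D UNIV \<and>
         continuous_linear sc sc (inv_into D (\<lambda>x. sc l x - A x))}"


subsection \<open>Riemann integral and convolution\<close>

text \<open>
  In contrast to \<^const>\<open>has_integral\<close> (which is restricted to normed spaces) the gauge is a
  constant \<open>\<delta>\<close>: the tagged partitions are those whose intervals lie within distance \<open>\<delta>\<close> of
  their tags, hence the integral is Riemann's.
\<close>

definition has_riemann_integral ::
    "('k::real_normed_field \<Rightarrow> 'a::{topological_space, ab_group_add} \<Rightarrow> 'a) \<Rightarrow>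
     real \<Rightarrow> real \<Rightarrow> (real \<Rightarrow> 'a) \<Rightarrow> 'a \<Rightarrow> bool" where
  "has_riemann_integral sc a b f I \<longleftrightarrow>
     (\<forall>U. open U \<and> I \<in> U \<longrightarrow> (\<exists>\<delta>>0. \<forall>D. D tagged_division_of {a..b} \<and> (\<lambda>x. ball x \<delta>) fine D \<longrightarrow>
        (\<Sum>(x, K)\<in>D. sc (of_real (measure lborel K)) (f x)) \<in> U))"

definition riemann_integral ::
    "('k::real_normed_field \<Rightarrow> 'a::{topological_space, ab_group_add} \<Rightarrow> 'a) \<Rightarrow>
     real \<Rightarrow> real \<Rightarrow> (real \<Rightarrow> 'a) \<Rightarrow> 'a" where
  "riemann_integral sc a b f = (THE I. has_riemann_integral sc a b f I)"

definition convolution ::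
    "('k::real_normed_field \<Rightarrow> 'a::{topological_space, ab_group_add} \<Rightarrow> 'a) \<Rightarrow>
     (real \<Rightarrow> 'a \<Rightarrow> 'a) \<Rightarrow> (real \<Rightarrow> 'a) \<Rightarrow> real \<Rightarrow> 'a" where
  "convolution sc T g t = riemann_integral sc 0 t (\<lambda>s. T (t - s) (g s))"


subsection \<open>Extrapolation space\<close>

text \<open>
  The extrapolation space is a complete Hausdorff locally convex space \<open>'b\<close> together with an
  embedding \<open>j\<close> of the original space \<open>'a\<close> with dense range, where \<open>'a\<close> carries the topology
  generated by the seminorms \<open>x \<mapsto> p (A\<inverse> x)\<close>. This determines \<open>('b, j)\<close> up to a unique
  isomorphism.
\<close>

definition extrapolation_space ::
    "('k::real_normed_field \<Rightarrow> 'a::{t2_space, ab_group_add} \<Rightarrow> 'a) \<Rightarrow> ('a \<Rightarrow> real) set \<Rightarrow>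
     (real \<Rightarrow> 'a \<Rightarrow> 'a) \<Rightarrow>
     ('k \<Rightarrow> 'b::{complete_uniform_space, uniform_topological_group_add, t2_space, ab_group_add} \<Rightarrow> 'b) \<Rightarrow>
     ('a \<Rightarrow> 'b) \<Rightarrow> bool" where
  "extrapolation_space sc \<Gamma> T sc' j \<longleftrightarrow>
     locally_convex_space sc' \<and>
     Vector_Spaces.linear sc sc' j \<and>
     closure (range j) = UNIV \<and>
     embedding_map
       (seminorm_topology UNIV
         ((\<lambda>p x. p (inv_into (generator_domain sc T) (generator sc T) x)) ` \<Gamma>))
       euclidean j"

definition extrapolated_semigroup ::
    "('k::field \<Rightarrow> 'b::{topological_space, ab_group_add} \<Rightarrow> 'b) \<Rightarrow> ('a \<Rightarrow> 'b) \<Rightarrow>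
     (real \<Rightarrow> 'a \<Rightarrow> 'a) \<Rightarrow> real \<Rightarrow> 'b \<Rightarrow> 'b" where
  "extrapolated_semigroup sc' j T t =
     (THE S. continuous_linear sc' sc' S \<and> (\<forall>x. S (j x) = j (T t x)))"

text \<open>The operator \<open>A\<^sub>-\<^sub>1\<close>, seen as a map from the original space \<open>'a\<close> to \<open>'b\<close>.\<close>

definition extrapolated_generator ::
    "('k::real_normed_field \<Rightarrow> 'b::{t2_space, ab_group_add} \<Rightarrow> 'b) \<Rightarrow> ('a \<Rightarrow> 'b) \<Rightarrow>
     (real \<Rightarrow> 'a \<Rightarrow> 'a) \<Rightarrow> 'a \<Rightarrow> 'b" where
  "extrapolated_generator sc' j T x = generator sc' (extrapolated_semigroup sc' j T) (j x)"


subsection \<open>Maximal regularity, admissibility, semivariation\<close>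

definition C_maximal_regularity ::
    "('k::real_normed_field \<Rightarrow> 'a::{t2_space, ab_group_add} \<Rightarrow> 'a) \<Rightarrow>
     (real \<Rightarrow> 'a \<Rightarrow> 'a) \<Rightarrow> real \<Rightarrow> bool" where
  "C_maximal_regularity sc T r \<longleftrightarrow>
     (\<forall>f. continuous_on {0..r} f \<longrightarrow>
        (\<forall>t\<in>{0..r}. convolution sc T f t \<in> generator_domain sc T) \<and>
        continuous_on {0..r} (\<lambda>t. generator sc T (convolution sc T f t)))"

text \<open>Admissibility of an operator \<open>B\<close> from the original space \<open>'a\<close> to the extrapolation space.\<close>

definition C_admissible ::
    "('k::real_normed_field \<Rightarrow> 'b::{topological_space, ab_group_add} \<Rightarrow> 'b) \<Rightarrow>
     ('a::topological_space \<Rightarrow> 'b) \<Rightarrow> (real \<Rightarrow> 'a \<Rightarrow> 'a) \<Rightarrow> ('a \<Rightarrow> 'b) \<Rightarrow> real \<Rightarrow> bool" where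
  "C_admissible sc' j T B r \<longleftrightarrow>
     (\<forall>f. continuous_on {0..r} f \<longrightarrow>
        convolution sc' (extrapolated_semigroup sc' j T) (\<lambda>s. B (f s)) r \<in> range j)"

definition semivariation ::
    "('a::ab_group_add \<Rightarrow> real) \<Rightarrow> ('a \<Rightarrow> real) \<Rightarrow> (real \<Rightarrow> 'a \<Rightarrow> 'a) \<Rightarrow> real \<Rightarrow> ereal" where
  "semivariation q p \<alpha> r =
     Sup {ereal (q (\<Sum>i=1..n. \<alpha> (d i) (x i) - \<alpha> (d (i - 1)) (x i))) |n d x.
            d 0 = 0 \<and> d n = r \<and> (\<forall>i<n. d i < d (Suc i)) \<and> (\<forall>i\<in>{1..n}. p (x i) \<le> 1)}"

definition bounded_semivariation ::
    "('a::ab_group_add \<Rightarrow> real) set \<Rightarrow> (real \<Rightarrow> 'a \<Rightarrow> 'a) \<Rightarrow> real \<Rightarrow> bool" where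
  "bounded_semivariation \<Gamma> \<alpha> r \<longleftrightarrow> (\<forall>q\<in>\<Gamma>. \<exists>p\<in>\<Gamma>. semivariation q p \<alpha> r < \<infinity>)"

text \<open>
  The space \<open>C([0,r];X)\<close>; functions are relevant on \<open>[0,r]\<close> only, the seminorms (and hence the
  topology) ignore their values elsewhere.
\<close>

definition C_space_topology ::
    "('a::{topological_space, ab_group_add} \<Rightarrow> real) set \<Rightarrow> real \<Rightarrow> (real \<Rightarrow> 'a) topology" where
  "C_space_topology \<Gamma> r =
     seminorm_topology {f. continuous_on {0..r} f} ((\<lambda>p f. SUP s\<in>{0..r}. p (f s)) ` \<Gamma>)"

text \<open>
  The notion is only meaningful if the convolutions at time \<open>r\<close> are in the domain of the generator;
  this presupposition is a premise of the continuity requirement.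
\<close>

definition three_C_space ::
    "('k::real_normed_field \<Rightarrow> 'a::{t2_space, ab_group_add} \<Rightarrow> 'a) \<Rightarrow> ('a \<Rightarrow> real) set \<Rightarrow>
     (real \<Rightarrow> 'a \<Rightarrow> 'a) \<Rightarrow> real \<Rightarrow> bool" where
  "three_C_space sc \<Gamma> T r \<longleftrightarrow>
     ((\<forall>f. continuous_on {0..r} f \<longrightarrow> convolution sc T f r \<in> generator_domain sc T) \<longrightarrow>
      continuous_map (C_space_topology \<Gamma> r) euclidean
        (\<lambda>f. generator sc T (convolution sc T f r)))"

end

theory Submission
  imports Defs
begin

text \<open>
  Put \<open>R = A\<inverse>\<close>, which is continuous and commutes with \<open>T(t)\<close>. As \<open>\<integral>\<^bsub>[a,b]\<^esub> T(u)x du = R(T(b)x - T(a)x)\<close>,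
  the integral \<open>(T * f)(t)\<close> is approximated by \<open>R z\<^sub>N(t)\<close>, where \<open>z\<^sub>N(t)\<close> is a Riemann--Stieltjes sum of
  \<open>f(t - u)\<close> against \<open>d T(u)\<close>. Bounded semivariation makes these sums uniformly Cauchy in \<open>t\<close>; their limit
  \<open>z\<close> is continuous and \<open>T * f = R z\<close>, which is maximal regularity.

  On the extrapolation space, \<open>A\<^sub>-\<^sub>1\<close> is a bijection with continuous inverse extending \<open>R\<close>, and
  \<open>(T\<^sub>-\<^sub>1 * A\<^sub>-\<^sub>1 f)(r) = A\<^sub>-\<^sub>1 (T * f)(r)\<close>. Hence admissibility says precisely that \<open>(T * f)(r) \<in> D(A)\<close>
  for all continuous \<open>f\<close>, which follows from maximal regularity. Conversely, in a \<open>3C\<close> space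
  \<open>f \<mapsto> A(T * f)(r)\<close> is bounded; testing it on continuous approximations of the step functions that give
  the sums \<open>\<Sum>(T(d\<^sub>i) - T(d\<^sub>i\<^sub>-\<^sub>1)) x\<^sub>i\<close> bounds the semivariation.
\<close>


subsection \<open>Seminorms and limits in locally convex spaces\<close>

text \<open>Without a norm every estimate costs a change of seminorm: \<open>q\<close> of a result
  is bounded by some \<open>p\<close> of the data, with constants that depend on the pair. Limits
  are therefore tested against one member of \<open>\<Gamma>\<close> at a time, and they run along
  filters of tagged divisions or of neighbourhoods, with completeness supplying the missing limits.
  The obstacle is that A is unbounded and cannot be moved through a limit; continuous maps replace
  it throughout. Towards maximal regularity the sums themselves converge, R is applied afterwards,
  and A reappears by inverting R. In the direction back to semivariation, difference quotients of T
  composed with R stand in for the identity A R. The nodes of the Stieltjes sums are i t / N. As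
  they scale with t, each sum is a continuous function of t, and the sums for N and M are compared
  through N M, which avoids refinements of general partitions. A_{-1} is constructed before T_{-1}:
  it is the limit of embedded difference quotients of T, and T_{-1}(t) is then written down by
  conjugation.\<close>

lemma seminorm_triangle: "seminorm sc p \<Longrightarrow> p (x + y) \<le> p x + p y"
  by (simp add: seminorm_def)

lemma seminorm_scale: "seminorm sc p \<Longrightarrow> p (sc c x) = norm c * p x"
  by (simp add: seminorm_def)

locale lcs = vector_space sc
  for sc :: "'k::real_normed_field \<Rightarrow>
      'a::{complete_uniform_space, uniform_topological_group_add, t2_space, ab_group_add} \<Rightarrow> 'a" +
  fixes \<Gamma> :: "('a \<Rightarrow> real) set"
  assumes convex_space: "locally_convex_space sc"
    and fundamental: "fundamental_system sc \<Gamma>"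
begin

definition rscale :: "real \<Rightarrow> 'a \<Rightarrow> 'a" (infixr "*\<^sub>r" 75)
  where "a *\<^sub>r x = sc (of_real a) x"

lemma rscale_simps [simp]:
  "0 *\<^sub>r x = 0" "1 *\<^sub>r x = x" "a *\<^sub>r 0 = 0" "a *\<^sub>r (b *\<^sub>r x) = (a * b) *\<^sub>r x"
  "a *\<^sub>r - x = - (a *\<^sub>r x)" "(- a) *\<^sub>r x = - (a *\<^sub>r x)"
  by (simp_all add: rscale_def)

lemma rscale_right_distrib: "a *\<^sub>r (x + y) = a *\<^sub>r x + a *\<^sub>r y"
  and rscale_right_diff: "a *\<^sub>r (x - y) = a *\<^sub>r x - a *\<^sub>r y"
  and rscale_left_diff: "(a - b) *\<^sub>r x = a *\<^sub>r x - b *\<^sub>r x"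
  by (simp_all add: rscale_def scale_right_distrib
      scale_right_diff_distrib scale_left_diff_distrib)

lemma rscale_sum_right: "a *\<^sub>r sum f S = (\<Sum>x\<in>S. a *\<^sub>r f x)"
  by (simp add: rscale_def scale_sum_right)

lemma rscale_sum_left: "sum f S *\<^sub>r x = (\<Sum>i\<in>S. f i *\<^sub>r x)"
  by (simp add: rscale_def scale_sum_left)

lemma sc_rscale: "sc c (a *\<^sub>r x) = a *\<^sub>r sc c x"
  by (simp add: rscale_def mult.commute)

lemma \<Gamma>_seminorm: "p \<in> \<Gamma> \<Longrightarrow> seminorm sc p"
  and \<Gamma>_continuous: "p \<in> \<Gamma> \<Longrightarrow> continuous_on UNIV p"
  using fundamental by (auto simp: fundamental_system_def)

lemma dominated:
  assumes "seminorm sc q" "continuous_on UNIV q"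
  obtains p C where "p \<in> \<Gamma>" "C \<ge> 0" "\<And>x. q x \<le> C * p x"
  using fundamental assms unfolding fundamental_system_def by blast

context
  fixes p assumes p: "seminorm sc p"
begin

lemma seminorm_zero: "p 0 = 0"
  using seminorm_scale[OF p, of 0 0] by simp

lemma seminorm_uminus: "p (- x) = p x"
  using seminorm_scale[OF p, of "-1" x] by simp

lemma seminorm_minus_commute: "p (x - y) = p (y - x)"
  using seminorm_uminus[of "x - y"] by simp

lemma seminorm_nonneg: "0 \<le> p x"
  using seminorm_triangle[OF p, of x "-x"] by (simp add: seminorm_uminus seminorm_zero)

lemma seminorm_diff_triangle: "p (x - z) \<le> p (x - y) + p (y - z)"
  using seminorm_triangle[OF p, of "x - y" "y - z"] by simp

lemma seminorm_rscale: "p (a *\<^sub>r x) = \<bar>a\<bar> * p x"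
  by (simp add: rscale_def seminorm_scale[OF p])

lemma seminorm_sum: "p (sum f S) \<le> (\<Sum>i\<in>S. p (f i))"
proof (induction S rule: infinite_finite_induct)
  case (insert x F)
  then show ?case using seminorm_triangle[OF p, of "f x" "sum f F"] by simp
qed (simp_all add: seminorm_zero)

end

text \<open>The sum of a finite family is again a continuous seminorm, so it lies below a multiple
  of one member of \<open>\<Gamma>\<close>, and each summand lies below the sum. This turns the
  finite families in \<open>seminorm_topology\<close> into single seminorms.\<close>

lemma dominated_finite:
  assumes "finite F" "F \<subseteq> {p. seminorm sc p \<and> continuous_on UNIV p}"
  obtains p C where "p \<in> \<Gamma>" "C \<ge> 0" "\<And>q x. q \<in> F \<Longrightarrow> q x \<le> C * p x"
proof -
  let ?s = "\<lambda>x. \<Sum>q\<in>F. q x"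
  have nonneg: "0 \<le> q x" if "q \<in> F" for q x using assms(2) that seminorm_nonneg by blast
  have "seminorm sc ?s"
    unfolding seminorm_def
  proof (intro conjI allI)
    show "?s (x + y) \<le> ?s x + ?s y" for x y
      unfolding sum.distrib[symmetric]
      by (rule sum_mono) (use assms(2) seminorm_triangle in blast)
    show "?s (sc c x) = norm c * ?s x" for c x
      unfolding sum_distrib_left
      by (rule sum.cong) (use assms(2) seminorm_scale in blast)+
  qed
  moreover have "continuous_on UNIV ?s"
    by (intro continuous_on_sum) (use assms(2) in blast)
  ultimately obtain p C where pC: "p \<in> \<Gamma>" "C \<ge> 0" "\<And>x. ?s x \<le> C * p x"
    using dominated by blast
  moreover have "q x \<le> C * p x" if "q \<in> F" for q x
    using pC(3)[of x] member_le_sum[OF that, of "\<lambda>q. q x"] nonneg assms(1) by force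
  ultimately show ?thesis using that by blast
qed

lemma nhd_base:
  assumes "open U" "l \<in> U"
  obtains p e where "p \<in> \<Gamma>" "e > 0" "{y. p (y - l) < e} \<subseteq> U"
proof -
  have "openin (seminorm_topology UNIV {p. seminorm sc p \<and> continuous_on UNIV p}) U"
    using convex_space assms(1) unfolding locally_convex_space_def by (metis open_openin)
  then obtain F e where F: "finite F" "F \<subseteq> {p. seminorm sc p \<and> continuous_on UNIV p}" "e > 0"
    "{y \<in> UNIV. \<forall>p\<in>F. p (y - l) < e} \<subseteq> U"
    unfolding openin_seminorm_topology using assms(2) by blast
  obtain p C where p: "p \<in> \<Gamma>" "C \<ge> 0" "\<And>q x. q \<in> F \<Longrightarrow> q x \<le> C * p x"
    using dominated_finite[OF F(1,2)] by blast
  \<comment> \<open>Dividing by \<open>C + 1\<close> also covers \<open>C = 0\<close>.\<close>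
  have "q (y - l) < e" if "p (y - l) < e / (C + 1)" "q \<in> F" for q y
  proof -
    have "(C + 1) * p (y - l) < e" using that(1) p(2) by (simp add: field_simps)
    moreover have "0 \<le> p (y - l)" using p(1) by (intro seminorm_nonneg \<Gamma>_seminorm)
    ultimately show ?thesis using p(3)[OF that(2), of "y - l"] by (simp add: algebra_simps)
  qed
  then have "{y. p (y - l) < e / (C + 1)} \<subseteq> U" using F(4) by blast
  then show ?thesis using that p(1,2) F(3) by (metis add_nonneg_pos divide_pos_pos zero_less_one)
qed

section \<open>Limits, continuity and completeness tested by seminorms\<close>

lemma tendsto_seminorm:
  assumes "continuous_on UNIV p" "(f \<longlongrightarrow> l) F"
  shows "((\<lambda>x. p (f x)) \<longlongrightarrow> p l) F"
  using continuous_on_tendsto_compose[OF assms(1) assms(2)] by simp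

lemma tendsto_sum_lcs:
  fixes f :: "'i \<Rightarrow> 'c \<Rightarrow> 'a"
  assumes "\<And>i. i \<in> S \<Longrightarrow> (f i \<longlongrightarrow> l i) F"
  shows "((\<lambda>x. \<Sum>i\<in>S. f i x) \<longlongrightarrow> (\<Sum>i\<in>S. l i)) F"
  using assms by (induction S rule: infinite_finite_induct) (auto intro: tendsto_add)

lemma continuous_on_sum_lcs:
  fixes f :: "'i \<Rightarrow> 'c::topological_space \<Rightarrow> 'a"
  assumes "\<And>i. i \<in> S \<Longrightarrow> continuous_on U (f i)"
  shows "continuous_on U (\<lambda>x. \<Sum>i\<in>S. f i x)"
  using assms unfolding continuous_on_def by (blast intro: tendsto_sum_lcs)

lemma tendsto_\<Gamma>I:
  assumes "\<And>p e. p \<in> \<Gamma> \<Longrightarrow> e > 0 \<Longrightarrow> \<forall>\<^sub>F x in F. p (f x - l) < e"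
  shows "(f \<longlongrightarrow> l) F"
proof (rule topological_tendstoI)
  fix U assume "open U" "l \<in> U"
  then obtain p e where "p \<in> \<Gamma>" "e > 0" "{y. p (y - l) < e} \<subseteq> U" by (rule nhd_base)
  with assms[of p e] show "\<forall>\<^sub>F x in F. f x \<in> U" by (auto elim: eventually_mono)
qed

lemma tendsto_\<Gamma>I_zero:
  assumes "\<And>p. p \<in> \<Gamma> \<Longrightarrow> ((\<lambda>x. p (f x - l)) \<longlongrightarrow> 0) F"
  shows "(f \<longlongrightarrow> l) F"
proof (rule tendsto_\<Gamma>I)
  fix p and e :: real assume "p \<in> \<Gamma>" "e > 0"
  then show "\<forall>\<^sub>F x in F. p (f x - l) < e"
    using order_tendstoD(2)[OF assms] by blast
qed

lemma tendsto_\<Gamma>D: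
  assumes "(f \<longlongrightarrow> l) F" "p \<in> \<Gamma>"
  shows "((\<lambda>x. p (f x - l)) \<longlongrightarrow> 0) F"
  using tendsto_seminorm[OF \<Gamma>_continuous[OF assms(2)] tendsto_diff[OF assms(1) tendsto_const[of l]]]
  by (simp add: seminorm_zero[OF \<Gamma>_seminorm[OF assms(2)]])

lemma tendsto_\<Gamma>D_less:
  assumes "(f \<longlongrightarrow> l) F" "p \<in> \<Gamma>" "e > 0"
  shows "\<forall>\<^sub>F x in F. p (f x - l) < e"
  using order_tendstoD(2)[OF tendsto_\<Gamma>D[OF assms(1,2)] assms(3)] .

lemma continuous_on_\<Gamma>_compose:
  "p \<in> \<Gamma> \<Longrightarrow> continuous_on S f \<Longrightarrow> continuous_on S (\<lambda>x. p (f x))"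
  using continuous_on_compose2[OF \<Gamma>_continuous] by blast

lemma tendsto_rscale:
  assumes "(f \<longlongrightarrow> a) F" "(g \<longlongrightarrow> x) F"
  shows "((\<lambda>u. f u *\<^sub>r g u) \<longlongrightarrow> a *\<^sub>r x) F"
proof (rule tendsto_\<Gamma>I_zero)
  fix p assume p: "p \<in> \<Gamma>"
  note sp = \<Gamma>_seminorm[OF p]
  have "((\<lambda>u. \<bar>f u\<bar> * p (g u - x) + \<bar>f u - a\<bar> * p x) \<longlongrightarrow> \<bar>a\<bar> * 0 + \<bar>a - a\<bar> * p x) F"
    by (intro tendsto_intros assms tendsto_\<Gamma>D[OF assms(2) p])
  moreover have "p (f u *\<^sub>r g u - a *\<^sub>r x) \<le> \<bar>f u\<bar> * p (g u - x) + \<bar>f u - a\<bar> * p x" for u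
    using seminorm_diff_triangle[OF sp, of "f u *\<^sub>r g u" "a *\<^sub>r x" "f u *\<^sub>r x"]
    by (simp add: seminorm_rscale[OF sp] flip: rscale_right_diff rscale_left_diff)
  ultimately show "((\<lambda>u. p (f u *\<^sub>r g u - a *\<^sub>r x)) \<longlongrightarrow> 0) F"
    using seminorm_nonneg[OF sp]
    by - (rule real_tendsto_sandwich[OF _ _ tendsto_const[of 0]], auto)
qed

lemma continuous_on_rscale:
  "continuous_on S f \<Longrightarrow> continuous_on S g \<Longrightarrow> continuous_on S (\<lambda>u. f u *\<^sub>r g u)"
  unfolding continuous_on_def using tendsto_rscale by blast

text \<open>Completeness enters here. The uniformity is that of the additive group, so a filter is
  Cauchy once the differences of its members tend to 0, and by \<open>nhd_base\<close> this can be
  checked for one seminorm at a time.\<close>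

lemma Cauchy_filter_converges:
  assumes "G \<noteq> bot"
    and "\<And>p e. p \<in> \<Gamma> \<Longrightarrow> e > 0 \<Longrightarrow> \<exists>P. eventually P G \<and> (\<forall>x y. P x \<longrightarrow> P y \<longrightarrow> p (x - y) < e)"
  obtains l where "G \<le> nhds l"
proof -
  have "cauchy_filter G"
    unfolding cauchy_filter_def cauchy_seq_finset_iff_vanishing
  proof (rule filter_leI)
    fix P :: "'a \<times> 'a \<Rightarrow> bool"
    assume "eventually P (filtercomap (\<lambda>(x,y). y - x) (nhds 0))"
    then obtain U where U: "open U" "0 \<in> U" "\<And>x y. y - x \<in> U \<Longrightarrow> P (x, y)"
      unfolding eventually_filtercomap eventually_nhds by fastforce
    obtain p e where p: "p \<in> \<Gamma>" "e > 0" "{y. p (y - 0) < e} \<subseteq> U"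
      using nhd_base[OF U(1,2)] .
    obtain Q where "eventually Q G" "\<And>x y. Q x \<Longrightarrow> Q y \<Longrightarrow> p (x - y) < e"
      using assms(2)[OF p(1,2)] by blast
    then show "eventually P (G \<times>\<^sub>F G)"
      unfolding eventually_prod_same using U(3) p(3) by (intro exI[of _ Q]) (simp add: subset_iff)
  qed
  then show ?thesis
    using that cauchy_filter_convergent'[OF _ assms(1)] unfolding convergent_filter_iff by blast
qed

lemma tendsto_Cauchy:
  assumes "F \<noteq> bot"
    and "\<And>p e. p \<in> \<Gamma> \<Longrightarrow> e > 0 \<Longrightarrow>
      \<exists>P. eventually P F \<and> (\<forall>u v. P u \<longrightarrow> P v \<longrightarrow> p (f u - f v) < e)"
  obtains l where "(f \<longlongrightarrow> l) F"
proof -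
  obtain l where "filtermap f F \<le> nhds l"
  proof (rule Cauchy_filter_converges[of "filtermap f F"])
    show "filtermap f F \<noteq> bot" using assms(1) by (simp add: filtermap_bot_iff)
    fix p and e :: real assume "p \<in> \<Gamma>" "e > 0"
    then obtain P where P: "eventually P F" "\<And>u v. P u \<Longrightarrow> P v \<Longrightarrow> p (f u - f v) < e"
      using assms(2) by blast
    then show "\<exists>P. eventually P (filtermap f F) \<and> (\<forall>x y. P x \<longrightarrow> P y \<longrightarrow> p (x - y) < e)"
      by (intro exI[of _ "\<lambda>x. \<exists>u. P u \<and> x = f u"])
         (auto simp: eventually_filtermap elim: eventually_mono)
  qed
  then show ?thesis using that by (simp add: filterlim_def)
qed

text \<open>Heine-Cantor is applied to the real function (s, t) -> p(f(s) - f(t)) on a compact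
  square. It vanishes on the diagonal, so comparing (s, t) with (t, t) gives the claim.\<close>

lemma uniformly_continuous_\<Gamma>:
  fixes f :: "real \<Rightarrow> 'a"
  assumes "continuous_on {a..b} f" "p \<in> \<Gamma>" "e > 0"
  obtains d where "d > 0" "\<And>s t. s \<in> {a..b} \<Longrightarrow> t \<in> {a..b} \<Longrightarrow> \<bar>s - t\<bar> < d \<Longrightarrow> p (f s - f t) < e"
proof -
  let ?g = "\<lambda>(s, t). p (f s - f t)"
  have "continuous_on ({a..b} \<times> {a..b}) ?g"
    unfolding split_def
    by (intro continuous_on_\<Gamma>_compose assms(2) continuous_on_diff
        continuous_on_compose2[OF assms(1)] continuous_intros) auto
  then have "uniformly_continuous_on ({a..b} \<times> {a..b}) ?g"
    by (intro compact_uniformly_continuous compact_Times) auto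
  then obtain d where d: "d > 0" "\<And>x y. x \<in> {a..b} \<times> {a..b} \<Longrightarrow> y \<in> {a..b} \<times> {a..b} \<Longrightarrow>
      dist y x < d \<Longrightarrow> dist (?g y) (?g x) < e"
    using assms(3) unfolding uniformly_continuous_on_def by metis
  have "p (f s - f t) < e" if "s \<in> {a..b}" "t \<in> {a..b}" "\<bar>s - t\<bar> < d" for s t
    using d(2)[of "(t, t)" "(s, t)"] that seminorm_nonneg[OF \<Gamma>_seminorm[OF assms(2)]]
    by (auto simp: dist_Pair_Pair dist_real_def seminorm_zero[OF \<Gamma>_seminorm[OF assms(2)]])
  then show ?thesis using that d(1) by blast
qed

end


subsection \<open>Riemann integrals of continuous functions\<close>

text \<open>Tagged divisions of mesh tending to 0, as a filter: being a Riemann integral becomes an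
  ordinary limit of Riemann sums.\<close>

definition fine_divisions :: "real \<Rightarrow> real \<Rightarrow> (real \<times> real set) set filter" where
  "fine_divisions a b =
    (INF \<delta>\<in>{0<..}. principal {D. D tagged_division_of {a..b} \<and> (\<lambda>x. ball x \<delta>) fine D})"

lemma eventually_fine_divisions:
  "eventually P (fine_divisions a b) \<longleftrightarrow>
    (\<exists>\<delta>>0. \<forall>D. D tagged_division_of {a..b} \<and> (\<lambda>x. ball x \<delta>) fine D \<longrightarrow> P D)"
proof -
  have "\<exists>x\<in>{0<..}. principal {D. D tagged_division_of {a..b} \<and> (\<lambda>y. ball y x) fine D}
      \<le> inf (principal {D. D tagged_division_of {a..b} \<and> (\<lambda>y. ball y d) fine D})
          (principal {D. D tagged_division_of {a..b} \<and> (\<lambda>y. ball y e) fine D})"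
    if "d > 0" "e > 0" for d e :: real
    using that by (intro bexI[of _ "min d e"]) (auto simp: fine_def subset_iff)
  then show ?thesis
    unfolding fine_divisions_def
    by (subst eventually_INF_base) (auto simp: eventually_principal greaterThan_def Bex_def intro: zero_less_one)
qed

lemma fine_divisions_neq_bot: "fine_divisions a b \<noteq> bot"
proof -
  have "\<exists>D. D tagged_division_of {a..b} \<and> (\<lambda>x. ball x \<delta>) fine D" if "\<delta> > 0" for \<delta>
    using fine_division_exists_real[OF gauge_ball[OF that]] by metis
  then show ?thesis
    unfolding trivial_limit_def eventually_fine_divisions by blast
qed

lemma has_riemann_integral_iff_tendsto:
  "has_riemann_integral sc a b f I \<longleftrightarrow>
    ((\<lambda>D. \<Sum>(x, K)\<in>D. sc (of_real (measure lborel K)) (f x)) \<longlongrightarrow> I) (fine_divisions a b)"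
  unfolding has_riemann_integral_def tendsto_def eventually_fine_divisions by blast

lemma has_riemann_integral_image:
  assumes "has_riemann_integral sc a b f I" "continuous_linear sc sc' L"
  shows "has_riemann_integral sc' a b (\<lambda>s. L (f s)) (L I)"
proof -
  interpret L: Vector_Spaces.linear sc sc' L using assms(2) by (simp add: continuous_linear_def)
  have "continuous_on UNIV L" using assms(2) by (simp add: continuous_linear_def)
  then have "((\<lambda>D. L (\<Sum>(x, K)\<in>D. sc (of_real (measure lborel K)) (f x))) \<longlongrightarrow> L I) (fine_divisions a b)"
    using assms(1) unfolding has_riemann_integral_iff_tendsto
    by (rule continuous_on_tendsto_compose) simp_all
  then show ?thesis
    unfolding has_riemann_integral_iff_tendsto by (simp add: L.sum L.scale case_prod_unfold)
qed

lemma has_riemann_integral_cong: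
  assumes "has_riemann_integral sc a b f I" "\<And>s. s \<in> {a..b} \<Longrightarrow> f s = g s"
  shows "has_riemann_integral sc a b g I"
proof -
  have "(\<Sum>(x, K)\<in>D. sc (of_real (measure lborel K)) (f x)) = (\<Sum>(x, K)\<in>D. sc (of_real (measure lborel K)) (g x))"
    if "D tagged_division_of {a..b}" for D
    using tagged_division_ofD(2,3)[OF that] assms(2) by (intro sum.cong) (auto, force)
  then show ?thesis
    using assms(1) unfolding has_riemann_integral_iff_tendsto
    by (elim Lim_transform_eventually) (auto simp: eventually_fine_divisions intro!: exI[of _ 1])
qed

text \<open>Both sides are the integral of the indicator function of \<open>{u..v}\<close>, computed
  once cell by cell and once over the whole interval.\<close>

lemma sum_content_Int:
  fixes a b :: real
  assumes "D tagged_division_of {a..b}" "{u..v} \<subseteq> {a..b}"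
  shows "(\<Sum>(x, K)\<in>D. measure lborel ({u..v} \<inter> K)) = measure lborel {u..v}"
proof -
  let ?f = "\<lambda>x. if x \<in> {u..v} then 1 else 0 :: real"
  have i: "integral (cbox c d) ?f = measure lborel ({u..v} \<inter> cbox c d)" for c d :: real
  proof -
    have "integral (cbox c d) ?f = integral ({u..v} \<inter> cbox c d) (\<lambda>_. 1)"
      by (rule integral_restrict_Int)
    also have "\<dots> = measure lborel ({u..v} \<inter> cbox c d)"
      by (simp add: Int_atLeastAtMost integral_const_real)
    finally show ?thesis .
  qed
  have "?f integrable_on cbox a b"
    unfolding integrable_restrict_Int
    by (simp add: Int_atLeastAtMost integrable_continuous_real)
  then have "integral (cbox a b) ?f = (\<Sum>(x, K)\<in>D. integral K ?f)"
    using assms(1) by (intro integral_combine_tagged_division_topdown) auto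
  also have "\<dots> = (\<Sum>(x, K)\<in>D. measure lborel ({u..v} \<inter> K))"
    using tagged_division_ofD(4)[OF assms(1)] i by (intro sum.cong) fastforce+
  moreover have "{u..v} \<inter> cbox a b = {u..v}" using assms(2) by auto
  ultimately show ?thesis using i[of a b] by metis
qed

section \<open>Riemann sums and the integral with values in X\<close>

context lcs
begin

abbreviation integ :: "real \<Rightarrow> real \<Rightarrow> (real \<Rightarrow> 'a) \<Rightarrow> 'a" where
  "integ \<equiv> riemann_integral sc"

abbreviation has_integ :: "real \<Rightarrow> real \<Rightarrow> (real \<Rightarrow> 'a) \<Rightarrow> 'a \<Rightarrow> bool" where
  "has_integ \<equiv> has_riemann_integral sc"

definition riemann_sum :: "(real \<Rightarrow> 'a) \<Rightarrow> (real \<times> real set) set \<Rightarrow> 'a" where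
  "riemann_sum f D = (\<Sum>(x, K)\<in>D. measure lborel K *\<^sub>r f x)"

lemma has_integ_iff: "has_integ a b f I \<longleftrightarrow> (riemann_sum f \<longlongrightarrow> I) (fine_divisions a b)"
  unfolding has_riemann_integral_iff_tendsto riemann_sum_def[abs_def] rscale_def ..

lemma has_integ_unique: "has_integ a b f I \<Longrightarrow> has_integ a b f J \<Longrightarrow> I = J"
  unfolding has_integ_iff using tendsto_unique[OF fine_divisions_neq_bot] by blast

lemma integ_eq: "has_integ a b f I \<Longrightarrow> integ a b f = I"
  unfolding riemann_integral_def using has_integ_unique by blast

text \<open>Passing to the cells \<open>K \<inter> L\<close> allows two divisions to be compared
  without constructing a common refinement as a tagged division.\<close>

lemma riemann_sum_refine:
  assumes D: "D tagged_division_of {a..b}" and E: "E tagged_division_of {a..b}"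
  shows "riemann_sum f D = (\<Sum>(x, K)\<in>D. \<Sum>(y, L)\<in>E. measure lborel (K \<inter> L) *\<^sub>r f x)"
  unfolding riemann_sum_def
proof (rule sum.cong[OF refl], clarify)
  fix x K assume xK: "(x, K) \<in> D"
  obtain u v where K: "K = {u..v}" using tagged_division_ofD(4)[OF D xK] by auto
  have "measure lborel K = (\<Sum>(y, L)\<in>E. measure lborel (K \<inter> L))"
    using sum_content_Int[OF E] tagged_division_ofD(3)[OF D xK] unfolding K by metis
  then show "measure lborel K *\<^sub>r f x = (\<Sum>(y, L)\<in>E. measure lborel (K \<inter> L) *\<^sub>r f x)"
    by (simp add: rscale_sum_left case_prod_unfold)
qed

text \<open>Disjoint cells have weight 0, so only tags of overlapping cells are compared, and the
  weights add up to the length of the interval.\<close>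

lemma riemann_sum_diff_le:
  assumes D: "D tagged_division_of {a..b}" and E: "E tagged_division_of {a..b}"
    and p: "seminorm sc p"
    and le: "\<And>x K y L. (x, K) \<in> D \<Longrightarrow> (y, L) \<in> E \<Longrightarrow> K \<inter> L \<noteq> {} \<Longrightarrow> p (f x - f y) \<le> \<eta>"
  shows "p (riemann_sum f D - riemann_sum f E) \<le> measure lborel {a..b} * \<eta>"
proof -
  have "riemann_sum f E = (\<Sum>(x, K)\<in>D. \<Sum>(y, L)\<in>E. measure lborel (K \<inter> L) *\<^sub>r f y)"
    unfolding riemann_sum_refine[OF E D] case_prod_unfold by (subst sum.swap) (simp add: Int_commute)
  then have "riemann_sum f D - riemann_sum f E =
      (\<Sum>(x, K)\<in>D. \<Sum>(y, L)\<in>E. measure lborel (K \<inter> L) *\<^sub>r (f x - f y))"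
    unfolding riemann_sum_refine[OF D E]
    by (simp add: case_prod_unfold rscale_right_diff flip: sum_subtractf)
  then have "p (riemann_sum f D - riemann_sum f E) \<le>
      (\<Sum>(x, K)\<in>D. \<Sum>(y, L)\<in>E. p (measure lborel (K \<inter> L) *\<^sub>r (f x - f y)))"
    unfolding case_prod_unfold
    by (auto intro!: order_trans[OF seminorm_sum[OF p]] sum_mono)
  also have "\<dots> \<le> (\<Sum>(x, K)\<in>D. \<Sum>(y, L)\<in>E. measure lborel (K \<inter> L) * \<eta>)"
  proof -
    have "p (measure lborel (K \<inter> L) *\<^sub>r (f x - f y)) \<le> measure lborel (K \<inter> L) * \<eta>"
      if "(x, K) \<in> D" "(y, L) \<in> E" for x K y L
      using le[OF that] by (cases "K \<inter> L = {}") (auto simp: seminorm_zero[OF p] seminorm_rscale[OF p] intro: mult_left_mono)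
    then show ?thesis by (intro sum_mono) (auto intro!: sum_mono)
  qed
  also have "\<dots> = (\<Sum>(x, K)\<in>D. measure lborel K * \<eta>)"
  proof (rule sum.cong[OF refl], clarify)
    fix x K assume xK: "(x, K) \<in> D"
    obtain u v where K: "K = {u..v}" using tagged_division_ofD(4)[OF D xK] by auto
    have "measure lborel K = (\<Sum>(y, L)\<in>E. measure lborel (K \<inter> L))"
      using sum_content_Int[OF E] tagged_division_ofD(3)[OF D xK] unfolding K by metis
    then show "(\<Sum>(y, L)\<in>E. measure lborel (K \<inter> L) * \<eta>) = measure lborel K * \<eta>"
      by (simp add: sum_distrib_right case_prod_unfold)
  qed
  also have "\<dots> = measure lborel {a..b} * \<eta>"
    using additive_content_tagged_division[of D a b] D
    by (simp add: case_prod_unfold flip: sum_distrib_right)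
  finally show ?thesis .
qed

lemma continuous_has_integ:
  assumes "continuous_on {a..b} f"
  shows "has_integ a b f (integ a b f)"
proof -
  obtain I where "(riemann_sum f \<longlongrightarrow> I) (fine_divisions a b)"
  proof (rule tendsto_Cauchy[OF fine_divisions_neq_bot])
    fix p and e :: real assume p: "p \<in> \<Gamma>" and e: "e > 0"
    define \<eta> where "\<eta> = e / (measure lborel {a..b} + 1)"
    have \<eta>: "\<eta> > 0" "measure lborel {a..b} * \<eta> < e"
      using e by (auto simp: \<eta>_def field_simps add_pos_nonneg)
    obtain d where d: "d > 0"
      "\<And>s t. s \<in> {a..b} \<Longrightarrow> t \<in> {a..b} \<Longrightarrow> \<bar>s - t\<bar> < d \<Longrightarrow> p (f s - f t) < \<eta>"
      using uniformly_continuous_\<Gamma>[OF assms p \<eta>(1)] by blast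
    \<comment> \<open>Tags of overlapping cells are both within \<open>d/2\<close> of a common
      point, hence less than \<open>d\<close> apart.\<close>
    let ?P = "\<lambda>D. D tagged_division_of {a..b} \<and> (\<lambda>x. ball x (d/2)) fine D"
    have "p (riemann_sum f D - riemann_sum f E) < e" if D: "?P D" and E: "?P E" for D E
    proof -
      have "p (riemann_sum f D - riemann_sum f E) \<le> measure lborel {a..b} * \<eta>"
      proof (rule riemann_sum_diff_le)
        fix x K y L assume *: "(x, K) \<in> D" "(y, L) \<in> E" "K \<inter> L \<noteq> {}"
        then obtain z where "z \<in> K" "z \<in> L" by blast
        then have "dist x z < d/2" "dist y z < d/2"
          using D E *(1,2) unfolding fine_def by (fastforce simp: subset_iff)+
        then have "\<bar>x - y\<bar> < d" unfolding dist_real_def by linarith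
        then show "p (f x - f y) \<le> \<eta>"
          using d(2)[of x y] D E * tagged_division_ofD(2,3) by (meson less_imp_le subsetD)
      qed (use D E p \<Gamma>_seminorm in auto)
      then show ?thesis using \<eta>(2) by simp
    qed
    moreover have "eventually ?P (fine_divisions a b)"
      unfolding eventually_fine_divisions using d(1) by (intro exI[of _ "d/2"]) auto
    ultimately show "\<exists>P. eventually P (fine_divisions a b) \<and>
        (\<forall>D E. P D \<longrightarrow> P E \<longrightarrow> p (riemann_sum f D - riemann_sum f E) < e)"
      by blast
  qed
  then have "has_integ a b f I" by (simp add: has_integ_iff)
  then show ?thesis using integ_eq by blast
qed

lemma has_integ_le:
  assumes "has_integ a b f I" "a \<le> b" "p \<in> \<Gamma>" "\<And>s. s \<in> {a..b} \<Longrightarrow> p (f s) \<le> \<eta>"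
  shows "p I \<le> \<eta> * (b - a)"
proof -
  note sp = \<Gamma>_seminorm[OF assms(3)]
  have "((\<lambda>D. p (riemann_sum f D)) \<longlongrightarrow> p I) (fine_divisions a b)"
    using assms(1) unfolding has_integ_iff by (rule tendsto_seminorm[OF \<Gamma>_continuous[OF assms(3)]])
  moreover have "p (riemann_sum f D) \<le> \<eta> * (b - a)" if D: "D tagged_division_of {a..b}" for D
  proof -
    have "p (riemann_sum f D) \<le> (\<Sum>(x, K)\<in>D. p (measure lborel K *\<^sub>r f x))"
      unfolding riemann_sum_def case_prod_unfold by (rule seminorm_sum[OF sp])
    also have "\<dots> \<le> (\<Sum>(x, K)\<in>D. measure lborel K * \<eta>)"
    proof (intro sum_mono, clarify)
      fix x K assume "(x, K) \<in> D"
      then have "p (f x) \<le> \<eta>" using tagged_division_ofD(2,3)[OF D] assms(4) by blast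
      then show "p (measure lborel K *\<^sub>r f x) \<le> measure lborel K * \<eta>"
        by (simp add: seminorm_rscale[OF sp] mult_left_mono)
    qed
    also have "\<dots> = \<eta> * (b - a)"
      using additive_content_tagged_division[of D a b] D assms(2)
      by (simp add: case_prod_unfold flip: sum_distrib_right)
    finally show ?thesis .
  qed
  then have "\<forall>\<^sub>F D in fine_divisions a b. p (riemann_sum f D) \<le> \<eta> * (b - a)"
    unfolding eventually_fine_divisions using zero_less_one by blast
  ultimately show ?thesis by (rule tendsto_upperbound[OF _ _ fine_divisions_neq_bot])
qed

lemma has_integ_diff:
  assumes "has_integ a b f I" "has_integ a b g J"
  shows "has_integ a b (\<lambda>s. f s - g s) (I - J)"
proof -
  have "riemann_sum (\<lambda>s. f s - g s) = (\<lambda>D. riemann_sum f D - riemann_sum g D)"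
    by (simp add: fun_eq_iff riemann_sum_def rscale_right_diff sum_subtractf case_prod_unfold)
  then show ?thesis using assms unfolding has_integ_iff by (simp add: tendsto_diff)
qed

lemma has_integ_rscale:
  assumes "has_integ a b f I"
  shows "has_integ a b (\<lambda>s. c *\<^sub>r f s) (c *\<^sub>r I)"
proof -
  have "riemann_sum (\<lambda>s. c *\<^sub>r f s) = (\<lambda>D. c *\<^sub>r riemann_sum f D)"
    by (simp add: fun_eq_iff riemann_sum_def rscale_sum_right case_prod_unfold mult.commute)
  then show ?thesis using assms unfolding has_integ_iff by (simp add: tendsto_rscale)
qed

lemma has_integ_sum:
  assumes "\<And>i. i \<in> S \<Longrightarrow> has_integ a b (f i) (I i)"
  shows "has_integ a b (\<lambda>s. \<Sum>i\<in>S. f i s) (\<Sum>i\<in>S. I i)"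
proof -
  have "riemann_sum (\<lambda>s. \<Sum>i\<in>S. f i s) = (\<lambda>D. \<Sum>i\<in>S. riemann_sum (f i) D)"
    by (simp add: fun_eq_iff riemann_sum_def rscale_sum_right case_prod_unfold sum.swap[of _ _ S])
  then show ?thesis using assms unfolding has_integ_iff by (simp add: tendsto_sum_lcs)
qed

lemma has_integ_const:
  assumes "a \<le> b"
  shows "has_integ a b (\<lambda>_. x) ((b - a) *\<^sub>r x)"
proof -
  have "riemann_sum (\<lambda>_. x) D = (b - a) *\<^sub>r x" if "D tagged_division_of {a..b}" for D
    using additive_content_tagged_division[of D a b] that assms
    unfolding riemann_sum_def by (simp add: case_prod_unfold flip: rscale_sum_left)
  then show ?thesis
    unfolding has_integ_iff
    by (intro tendsto_eventually) (auto simp: eventually_fine_divisions intro!: exI[of _ 1])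
qed

text \<open>The union of fine divisions of the two parts is a fine division of the whole. So the
  union map carries the product filter into the filter of the whole interval, and both sides are
  limits of the same sums.\<close>

lemma has_integ_combine:
  assumes "has_integ a c f I" "has_integ c b f J" "has_integ a b f S" "a \<le> c" "c \<le> b"
  shows "S = I + J"
proof -
  let ?F = "fine_divisions a c \<times>\<^sub>F fine_divisions c b"
  let ?P = "\<lambda>\<delta> a b D. D tagged_division_of {a..b} \<and> (\<lambda>x. ball x \<delta>) fine D"
  have Un: "?P \<delta> a b (D \<union> E)" if "?P \<delta> a c D" "?P \<delta> c b E" for D E and \<delta> :: real
  proof -
    have "(D \<union> E) tagged_division_of ({a..c} \<union> {c..b})"
      using that by (intro tagged_division_Un) auto
    moreover have "{a..c} \<union> {c..b} = {a..b}" using assms(4,5) by auto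
    ultimately show ?thesis using that fine_Un by auto
  qed
  have "riemann_sum f (D \<union> E) = riemann_sum f D + riemann_sum f E"
    if D: "?P 1 a c D" and E: "?P 1 c b E" for D E
    unfolding riemann_sum_def
  proof (rule sum.union_inter_neutral)
    show "finite D" "finite E" using D E tagged_division_of_finite by blast+
    \<comment> \<open>A cell that occurs in both divisions is contained in \<open>{c}\<close> and
      has content 0.\<close>
    show "\<forall>u\<in>D \<inter> E. (case u of (x, K) \<Rightarrow> measure lborel K *\<^sub>r f x) = 0"
    proof clarify
      fix x K assume *: "(x, K) \<in> D" "(x, K) \<in> E"
      then obtain u v where K: "K = {u..v}" using D tagged_division_ofD(4) by (metis box_real(2))
      have "K \<subseteq> {a..c}" "K \<subseteq> {c..b}" using * D E tagged_division_ofD(3) by blast+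
      then have "measure lborel K = 0" unfolding K by (auto simp: content_real_if)
      then show "measure lborel K *\<^sub>r f x = 0" by simp
    qed
  qed
  then have ev: "\<forall>\<^sub>F u in ?F. riemann_sum f (fst u) + riemann_sum f (snd u) = riemann_sum f (fst u \<union> snd u)"
    unfolding eventually_prod_filter eventually_fine_divisions
    by (intro exI[of _ "?P 1 a c"] exI[of _ "?P 1 c b"]) (auto intro!: exI[of _ 1])
  have "((\<lambda>u. riemann_sum f (fst u) + riemann_sum f (snd u)) \<longlongrightarrow> I + J) ?F"
    using assms(1,2) unfolding has_integ_iff
    by (intro tendsto_add filterlim_compose[OF _ filterlim_fst] filterlim_compose[OF _ filterlim_snd])
  then have "((\<lambda>u. riemann_sum f (fst u \<union> snd u)) \<longlongrightarrow> I + J) ?F"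
    using ev by (rule Lim_transform_eventually)
  moreover have "filterlim (\<lambda>u. fst u \<union> snd u) (fine_divisions a b) ?F"
    unfolding filterlim_iff
  proof (intro allI impI)
    fix Q :: "(real \<times> real set) set \<Rightarrow> bool" assume "eventually Q (fine_divisions a b)"
    then obtain \<delta> where \<delta>: "\<delta> > 0" "\<And>D. ?P \<delta> a b D \<Longrightarrow> Q D"
      unfolding eventually_fine_divisions by blast
    show "\<forall>\<^sub>F u in ?F. Q (fst u \<union> snd u)"
      unfolding eventually_prod_filter
    proof (rule exI[of _ "?P \<delta> a c"], rule exI[of _ "?P \<delta> c b"], intro conjI allI impI)
      show "eventually (?P \<delta> a c) (fine_divisions a c)" "eventually (?P \<delta> c b) (fine_divisions c b)"
        unfolding eventually_fine_divisions using \<delta>(1) by blast+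
      show "Q (fst (D, E) \<union> snd (D, E))" if "?P \<delta> a c D" "?P \<delta> c b E" for D E
        using \<delta>(2) Un[OF that] by simp
    qed
  qed
  then have "((\<lambda>u. riemann_sum f (fst u \<union> snd u)) \<longlongrightarrow> S) ?F"
    using assms(3) unfolding has_integ_iff by (rule filterlim_compose[rotated])
  ultimately show ?thesis
    by (intro tendsto_unique[of ?F _ S "I + J"]) (simp_all add: prod_filter_eq_bot fine_divisions_neq_bot)
qed

lemma integ_combine:
  assumes "continuous_on {a..b} f" "a \<le> c" "c \<le> b"
  shows "integ a b f = integ a c f + integ c b f"
  by (rule has_integ_combine[OF _ _ _ assms(2,3)])
     (use assms in \<open>auto intro!: continuous_has_integ intro: continuous_on_subset\<close>)

lemma integ_empty: "integ a a f = 0"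
proof -
  have "has_integ a a f 0"
    by (rule has_riemann_integral_cong[OF has_integ_const[of a a "f a", simplified]]) auto
  then show ?thesis by (rule integ_eq)
qed

lemma integ_sum_pieces:
  fixes c :: "nat \<Rightarrow> real"
  assumes "continuous_on {c 0..c n} f" "\<And>i. i < n \<Longrightarrow> c i \<le> c (Suc i)"
  shows "integ (c 0) (c n) f = (\<Sum>i<n. integ (c i) (c (Suc i)) f)"
  using assms
proof (induction n)
  case (Suc n)
  have "c 0 \<le> c n" by (rule lift_Suc_mono_le_ivl[where N = "{..<n}"]) (use Suc.prems in auto)
  then have "integ (c 0) (c (Suc n)) f = integ (c 0) (c n) f + integ (c n) (c (Suc n)) f"
    using Suc.prems by (intro integ_combine) auto
  also have "integ (c 0) (c n) f = (\<Sum>i<n. integ (c i) (c (Suc i)) f)"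
      by (intro Suc.IH continuous_on_subset[OF Suc.prems(1)]) (use Suc.prems(2) Suc.prems(2)[of n] in auto)
  finally show ?case by simp
qed (simp add: integ_empty)

text \<open>The integrands \<open>g i\<close> are simpler than \<open>f\<close> and have known
  integrals: constants in the midpoint sums, orbits of a fixed vector in the Stieltjes sums.\<close>

lemma integ_approx_pieces:
  fixes c :: "nat \<Rightarrow> real"
  assumes f: "continuous_on {c 0..c n} f" and c: "\<And>i. i < n \<Longrightarrow> c i \<le> c (Suc i)"
    and g: "\<And>i. i < n \<Longrightarrow> has_integ (c i) (c (Suc i)) (g i) (J i)"
    and p: "p \<in> \<Gamma>"
    and le: "\<And>i s. i < n \<Longrightarrow> s \<in> {c i..c (Suc i)} \<Longrightarrow> p (f s - g i s) \<le> \<eta>"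
  shows "p (integ (c 0) (c n) f - (\<Sum>i<n. J i)) \<le> \<eta> * (c n - c 0)"
proof -
  have mono: "c i \<le> c j" if "i \<le> j" "j \<le> n" for i j
    by (rule lift_Suc_mono_le_ivl[where N = "{..<n}"]) (use c that in auto)
  have "integ (c 0) (c n) f - (\<Sum>i<n. J i) = (\<Sum>i<n. integ (c i) (c (Suc i)) f - J i)"
    by (simp add: integ_sum_pieces[OF f c] sum_subtractf)
  then have "p (integ (c 0) (c n) f - (\<Sum>i<n. J i)) \<le> (\<Sum>i<n. p (integ (c i) (c (Suc i)) f - J i))"
    using seminorm_sum[OF \<Gamma>_seminorm[OF p]] by simp
  also have "\<dots> \<le> (\<Sum>i<n. \<eta> * (c (Suc i) - c i))"
  proof (rule sum_mono)
    fix i assume i: "i \<in> {..<n}"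
    have "continuous_on {c i..c (Suc i)} f"
      by (rule continuous_on_subset[OF f]) (use i mono[of 0 i] mono[of "Suc i" n] in auto)
    then show "p (integ (c i) (c (Suc i)) f - J i) \<le> \<eta> * (c (Suc i) - c i)"
      by (intro has_integ_le[OF has_integ_diff[OF continuous_has_integ g]] c p le) (use i in auto)
  qed
  also have "\<dots> = \<eta> * (c n - c 0)"
    by (simp add: sum_lessThan_telescope flip: sum_distrib_left)
  finally show ?thesis .
qed

text \<open>Translations and reflections send the midpoints of an equidistant division to midpoints.
  Changes of variables thereby reduce to identities between finite sums.\<close>

lemma midpoint_sums_tendsto:
  assumes f: "continuous_on {a..b} f" and ab: "a \<le> b"
  shows "(\<lambda>n. \<Sum>i<Suc n. ((b - a) / Suc n) *\<^sub>r f (a + (i + 1/2) * ((b - a) / Suc n))) \<longlonglongrightarrow> integ a b f"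
proof (rule tendsto_\<Gamma>I)
  fix p and e :: real assume p: "p \<in> \<Gamma>" and e: "e > 0"
  define \<eta> where "\<eta> = e / (b - a + 1)"
  have \<eta>: "\<eta> > 0" "\<eta> * (b - a) < e"
    using e ab by (auto simp: \<eta>_def field_simps add_pos_nonneg)
  obtain d where d: "d > 0"
    "\<And>s t. s \<in> {a..b} \<Longrightarrow> t \<in> {a..b} \<Longrightarrow> \<bar>s - t\<bar> < d \<Longrightarrow> p (f s - f t) < \<eta>"
    using uniformly_continuous_\<Gamma>[OF f p \<eta>(1)] by blast
  have "(\<lambda>n. (b - a) / Suc n) \<longlonglongrightarrow> 0" by (rule LIMSEQ_Suc[OF lim_const_over_n])
  then have "\<forall>\<^sub>F n in sequentially. (b - a) / Suc n < d"
    using d(1) order_tendstoD(2) by blast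
  then show "\<forall>\<^sub>F n in sequentially.
    p ((\<Sum>i<Suc n. ((b - a) / Suc n) *\<^sub>r f (a + (i + 1/2) * ((b - a) / Suc n))) - integ a b f) < e"
  proof eventually_elim
    case (elim n)
    define w where "w = (b - a) / Suc n"
    define c where "c = (\<lambda>i. a + real i * w)"
    have w: "w \<ge> 0" "w < d" using ab elim by (auto simp: w_def)
    have sw: "real (Suc n) * w = b - a" by (simp add: w_def del: of_nat_Suc)
    have c: "c 0 = a" "c (Suc n) = b" "\<And>i. c (Suc i) = c i + w"
      using sw by (simp_all add: c_def algebra_simps)
    have bd: "c i \<ge> a" "c i + w \<le> b" if "i < Suc n" for i
    proof -
      have "real (Suc i) * w \<le> real (Suc n) * w" using that w(1) by (intro mult_right_mono) auto
      also have "\<dots> = b - a" by (simp add: w_def)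
      finally show "c i + w \<le> b" by (simp add: c_def algebra_simps)
    qed (use w in \<open>simp add: c_def\<close>)
    have "p (integ (c 0) (c (Suc n)) f - (\<Sum>i<Suc n. w *\<^sub>r f (c i + w/2))) \<le> \<eta> * (c (Suc n) - c 0)"
    proof (rule integ_approx_pieces[where g = "\<lambda>i _. f (c i + w/2)"])
      show "has_integ (c i) (c (Suc i)) (\<lambda>_. f (c i + w / 2)) (w *\<^sub>r f (c i + w / 2))" for i
        using has_integ_const[of "c i" "c (Suc i)" "f (c i + w/2)"] c w by simp
      show "p (f s - f (c i + w / 2)) \<le> \<eta>" if "i < Suc n" "s \<in> {c i..c (Suc i)}" for i s
        using that bd[OF that(1)] w c by (intro less_imp_le[OF d(2)]) (auto simp: abs_less_iff)
    qed (use c w f p in auto)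
    moreover have "c i + w/2 = a + (i + 1/2) * w" for i by (simp add: c_def algebra_simps)
    ultimately show ?case
      using \<eta>(2) c seminorm_minus_commute[OF \<Gamma>_seminorm[OF p]] by (simp add: w_def)
  qed
qed

lemma integ_reflect:
  assumes f: "continuous_on {c - b..c - a} f" and ab: "a \<le> b"
  shows "integ a b (\<lambda>s. f (c - s)) = integ (c - b) (c - a) f"
proof -
  have g: "continuous_on {a..b} (\<lambda>s. f (c - s))"
    by (rule continuous_on_compose2[OF f]) (auto intro!: continuous_intros)
  have "(\<Sum>i<Suc n. ((b - a) / Suc n) *\<^sub>r f (c - (a + (i + 1/2) * ((b - a) / Suc n)))) =
      (\<Sum>i<Suc n. ((b - a) / Suc n) *\<^sub>r f (c - b + (i + 1/2) * ((b - a) / Suc n)))" for n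
  proof -
    \<comment> \<open>Counting the cells from the other end replaces \<open>i\<close> by
      \<open>n - i\<close>.\<close>
    have *: "c - (a + (real (Suc n - Suc i) + 1/2) * ((b - a) / Suc n)) = c - b + (i + 1/2) * ((b - a) / Suc n)"
      if "i < Suc n" for i
    proof -
      define w where "w = (b - a) / Suc n"
      have "b = a + Suc n * w" by (simp add: w_def)
      moreover have "real (Suc n - Suc i) = real n - real i" using that by (simp add: of_nat_diff)
      ultimately show ?thesis unfolding w_def[symmetric] by (simp add: algebra_simps)
    qed
    show ?thesis
      by (subst sum.nat_diff_reindex[symmetric], rule sum.cong) (simp_all only: * lessThan_iff)
  qed
  then show ?thesis
    using LIMSEQ_unique midpoint_sums_tendsto[OF g ab] midpoint_sums_tendsto[OF f] ab
    by simp
qed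

lemma integ_shift:
  assumes f: "continuous_on {a + h..b + h} f" and ab: "a \<le> b"
  shows "integ a b (\<lambda>s. f (s + h)) = integ (a + h) (b + h) f"
proof -
  have g: "continuous_on {a..b} (\<lambda>s. f (s + h))"
    by (rule continuous_on_compose2[OF f]) (auto intro!: continuous_intros)
  have "(\<lambda>n. \<Sum>i<Suc n. ((b - a) / Suc n) *\<^sub>r f (a + h + (i + 1/2) * ((b - a) / Suc n)))
      \<longlonglongrightarrow> integ a b (\<lambda>s. f (s + h))"
    using midpoint_sums_tendsto[OF g ab] by (simp only: ac_simps)
  then show ?thesis
    using LIMSEQ_unique midpoint_sums_tendsto[OF f] ab by fastforce
qed

end


subsection \<open>Semigroups with invertible generator\<close>

lemma continuous_linear_iff:
  "continuous_linear sc sc' L \<longleftrightarrow> vector_space sc \<and> vector_space sc' \<and>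
    (\<forall>x y. L (x + y) = L x + L y) \<and> (\<forall>c x. L (sc c x) = sc' c (L x)) \<and> continuous_on UNIV L"
  unfolding continuous_linear_def Vector_Spaces.linear_iff by auto

lemma continuous_linear_tendsto:
  assumes "continuous_linear sc sc' L" "(f \<longlongrightarrow> l) F"
  shows "((\<lambda>u. L (f u)) \<longlongrightarrow> L l) F"
  using assms unfolding continuous_linear_def by (auto intro: continuous_on_tendsto_compose)

lemma continuous_linear_simps:
  assumes "continuous_linear sc sc' L"
  shows "L (x + y) = L x + L y" "L (x - y) = L x - L y" "L 0 = 0" "L (- x) = - L x"
    "L (sc c x) = sc' c (L x)" "L (sum f S) = (\<Sum>i\<in>S. L (f i))"
proof -
  interpret Vector_Spaces.linear sc sc' L using assms by (simp add: continuous_linear_def)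
  show "L (x + y) = L x + L y" "L (x - y) = L x - L y" "L 0 = 0" "L (- x) = - L x"
    "L (sc c x) = sc' c (L x)" "L (sum f S) = (\<Sum>i\<in>S. L (f i))"
    by (simp_all add: add diff zero neg scale sum)
qed

lemma continuous_linear_compose:
  "continuous_linear sc1 sc2 L \<Longrightarrow> continuous_linear sc2 sc3 K \<Longrightarrow> continuous_linear sc1 sc3 (\<lambda>x. K (L x))"
  unfolding continuous_linear_iff by (auto intro: continuous_on_compose2)

context lcs
begin

lemma continuous_linear_rscale: "continuous_linear sc sc L \<Longrightarrow> L (a *\<^sub>r x) = a *\<^sub>r L x"
  by (simp add: rscale_def continuous_linear_simps)

lemma average_tendsto:
  assumes f: "continuous_on {c..} f"
  shows "((\<lambda>h. (1 / h) *\<^sub>r integ c (c + h) f) \<longlongrightarrow> f c) (at_right 0)"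
proof (rule tendsto_\<Gamma>I)
  fix p and e :: real assume p: "p \<in> \<Gamma>" and e: "e > 0"
  note sp = \<Gamma>_seminorm[OF p]
  have "continuous_on {c..c + 1} f" by (rule continuous_on_subset[OF f]) auto
  then obtain d where d: "d > 0"
    "\<And>s t. s \<in> {c..c+1} \<Longrightarrow> t \<in> {c..c+1} \<Longrightarrow> \<bar>s - t\<bar> < d \<Longrightarrow> p (f s - f t) < e/2"
    using uniformly_continuous_\<Gamma>[OF _ p, of c "c + 1" f "e/2"] e by auto
  have "p ((1 / h) *\<^sub>r integ c (c + h) f - f c) < e" if h: "0 < h" "h < min d 1" for h
  proof -
    have le: "p (f s - f c) \<le> e/2" if "s \<in> {c..c + h}" for s
      using d(2)[of s c] that h by (auto intro: less_imp_le)
    have "continuous_on {c..c + h} f" by (rule continuous_on_subset[OF f]) auto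
    moreover have "has_integ c (c + h) (\<lambda>_. f c) (h *\<^sub>r f c)"
      using has_integ_const[of c "c + h" "f c"] h by simp
    ultimately have "has_integ c (c + h) (\<lambda>s. f s - f c) (integ c (c + h) f - h *\<^sub>r f c)"
      by (intro has_integ_diff continuous_has_integ)
    then have "p (integ c (c + h) f - h *\<^sub>r f c) \<le> e/2 * (c + h - c)"
      by (rule has_integ_le) (use h p le in auto)
    moreover have "(1 / h) *\<^sub>r integ c (c + h) f - f c = (1 / h) *\<^sub>r (integ c (c + h) f - h *\<^sub>r f c)"
      using h by (simp add: rscale_right_diff)
    ultimately have "p ((1 / h) *\<^sub>r integ c (c + h) f - f c) \<le> e / 2"
      using h by (simp add: seminorm_rscale[OF sp] field_simps)
    then show ?thesis using e by simp
  qed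
  then show "\<forall>\<^sub>F h in at_right 0. p ((1 / h) *\<^sub>r integ c (c + h) f - f c) < e"
    using d(1) by (intro eventually_at_rightI[of 0 "min d 1"]) auto
qed

end

section \<open>The semigroup, its generator and the inverse R\<close>

locale lcs_semigroup = lcs sc \<Gamma>
  for sc :: "'k::real_normed_field \<Rightarrow>
      'a::{complete_uniform_space, uniform_topological_group_add, t2_space, ab_group_add} \<Rightarrow> 'a"
    and \<Gamma> :: "('a \<Rightarrow> real) set" +
  fixes T :: "real \<Rightarrow> 'a \<Rightarrow> 'a"
  assumes semigroup: "strongly_continuous_semigroup sc T"
    and equicontinuous: "quasi_equicontinuous sc \<Gamma> T"
    and invertible: "0 \<in> resolvent_set sc (generator_domain sc T) (generator sc T)"
begin

abbreviation D :: "'a set" where "D \<equiv> generator_domain sc T"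
abbreviation A :: "'a \<Rightarrow> 'a" where "A \<equiv> generator sc T"

lemma T_continuous_linear: "t \<ge> 0 \<Longrightarrow> continuous_linear sc sc (T t)"
  and T_0: "T 0 x = x"
  and T_add: "t \<ge> 0 \<Longrightarrow> s \<ge> 0 \<Longrightarrow> T (t + s) x = T t (T s x)"
  and T_orbit: "continuous_on {0..} (\<lambda>t. T t x)"
  using semigroup by (auto simp: strongly_continuous_semigroup_def)

lemmas T_simps = continuous_linear_simps[OF T_continuous_linear] continuous_linear_rscale[OF T_continuous_linear]

text \<open>On a bounded interval the exponential factor of quasi-equicontinuity is absorbed into
  the constant, which leaves local equicontinuity.\<close>

lemma T_bounded:
  assumes "q \<in> \<Gamma>"
  obtains p M where "p \<in> \<Gamma>" "M > 0" "\<And>t x. t \<in> {0..r} \<Longrightarrow> q (T t x) \<le> M * p x"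
proof -
  obtain \<omega> where "\<forall>q\<in>\<Gamma>. \<exists>p\<in>\<Gamma>. \<exists>C\<ge>0. \<forall>t\<ge>0. \<forall>x. q (exp (- \<omega> * t) *\<^sub>r T t x) \<le> C * p x"
    using equicontinuous unfolding quasi_equicontinuous_def rscale_def by blast
  then obtain p C where p: "p \<in> \<Gamma>" "C \<ge> 0"
    and le: "\<And>t x. t \<ge> 0 \<Longrightarrow> q (exp (- \<omega> * t) *\<^sub>r T t x) \<le> C * p x"
    using assms by blast
  \<comment> \<open>The absolute value covers negative \<open>\<omega>\<close>; \<open>C + 1\<close>
    makes the constant positive, so that one may divide by it.\<close>
  have "q (T t x) \<le> ((C + 1) * exp (\<bar>\<omega>\<bar> * r)) * p x" if "t \<in> {0..r}" for t x
  proof -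
    have "p x \<ge> 0" using p(1) by (intro seminorm_nonneg \<Gamma>_seminorm)
    have "q (T t x) = exp (\<omega> * t) * q (exp (- \<omega> * t) *\<^sub>r T t x)"
      by (simp add: seminorm_rscale[OF \<Gamma>_seminorm[OF assms]] flip: mult.assoc exp_add)
    also have "\<dots> \<le> exp (\<omega> * t) * (C * p x)" using that by (intro mult_left_mono le) auto
    also have "\<dots> \<le> exp (\<bar>\<omega>\<bar> * r) * ((C + 1) * p x)"
    proof (intro mult_mono)
      have "\<omega> * t \<le> \<bar>\<omega>\<bar> * t" using that by (intro mult_right_mono) auto
      also have "\<dots> \<le> \<bar>\<omega>\<bar> * r" using that by (intro mult_left_mono) auto
      finally have "\<omega> * t \<le> \<bar>\<omega>\<bar> * r" .
      then show "exp (\<omega> * t) \<le> exp (\<bar>\<omega>\<bar> * r)" by simp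
    qed (use \<open>p x \<ge> 0\<close> p in auto)
    finally show ?thesis by (simp add: mult_ac)
  qed
  then show ?thesis using that p by (metis add_nonneg_pos exp_gt_zero mult_pos_pos zero_less_one)
qed

text \<open>Strong continuity and local equicontinuity give joint continuity: the change of the
  vector is estimated by one seminorm uniformly in time, and what remains is the orbit of the fixed
  vector \<open>g s\<close>.\<close>

lemma continuous_on_T_apply:
  fixes u :: "'c::topological_space \<Rightarrow> real"
  assumes u: "continuous_on S u" "u ` S \<subseteq> {0..r}" and g: "continuous_on S g"
  shows "continuous_on S (\<lambda>s. T (u s) (g s))"
  unfolding continuous_on_def
proof (intro ballI tendsto_\<Gamma>I_zero)
  fix s q assume s: "s \<in> S" and q: "q \<in> \<Gamma>"
  note sq = \<Gamma>_seminorm[OF q]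
  obtain p M where p: "p \<in> \<Gamma>" "M > 0" "\<And>t x. t \<in> {0..r} \<Longrightarrow> q (T t x) \<le> M * p x"
    using T_bounded[OF q] by metis
  have "((\<lambda>v. T (u v) (g s)) \<longlongrightarrow> T (u s) (g s)) (at s within S)"
    using continuous_on_compose2[OF T_orbit[of "g s"] u(1)] u(2) s unfolding continuous_on_def by fastforce
  then have "((\<lambda>v. M * p (g v - g s) + q (T (u v) (g s) - T (u s) (g s))) \<longlongrightarrow> M * 0 + 0) (at s within S)"
    using g s unfolding continuous_on_def by (intro tendsto_intros tendsto_\<Gamma>D p q) blast+
  moreover have "q (T (u v) (g v) - T (u s) (g s)) \<le> M * p (g v - g s) + q (T (u v) (g s) - T (u s) (g s))"
    if "v \<in> S" for v
  proof -
    have "u v \<in> {0..r}" using that u(2) by blast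
    then have "q (T (u v) (g v) - T (u v) (g s)) \<le> M * p (g v - g s)"
      using p(3)[of "u v" "g v - g s"] by (simp add: T_simps)
    then show ?thesis
      using seminorm_diff_triangle[OF sq, of "T (u v) (g v)" "T (u s) (g s)" "T (u v) (g s)"] by simp
  qed
  then have "\<forall>\<^sub>F v in at s within S. q (T (u v) (g v) - T (u s) (g s)) \<le>
      M * p (g v - g s) + q (T (u v) (g s) - T (u s) (g s))"
    by (auto simp: eventually_at_topological)
  ultimately show "((\<lambda>v. q (T (u v) (g v) - T (u s) (g s))) \<longlongrightarrow> 0) (at s within S)"
    by - (rule real_tendsto_sandwich[OF _ _ tendsto_const[of 0]], auto simp: seminorm_nonneg[OF sq])
qed

lemma generatorI:
  assumes "((\<lambda>t. (1 / t) *\<^sub>r (T t x - x)) \<longlongrightarrow> y) (at_right 0)"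
  shows "x \<in> D" "A x = y"
proof -
  show "x \<in> D" using assms unfolding generator_domain_def rscale_def by blast
  show "A x = y"
    using assms unfolding generator_def rscale_def by (intro tendsto_Lim) auto
qed

lemma generatorD:
  assumes "x \<in> D"
  shows "((\<lambda>t. (1 / t) *\<^sub>r (T t x - x)) \<longlongrightarrow> A x) (at_right 0)"
  using assms generatorI unfolding generator_domain_def rscale_def by blast

definition R :: "'a \<Rightarrow> 'a" where "R = inv_into D A"

lemma bij_A: "bij_betw A D UNIV"
proof -
  have "bij_betw (\<lambda>x. - A x) D UNIV"
    using invertible by (simp add: resolvent_set_def)
  then have "inj_on A D" and *: "y \<in> (\<lambda>x. - A x) ` D" for y
    by (auto simp: bij_betw_def inj_on_def)
  moreover have "y \<in> A ` D" for y
    using *[of "- y"] by (auto simp: image_iff)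
  ultimately show ?thesis by (auto simp: bij_betw_def)
qed

lemma R_in_D [simp]: "R x \<in> D"
  and A_R [simp]: "A (R x) = x"
  using bij_betwE[OF bij_betw_inv_into[OF bij_A]] bij_betw_inv_into_right[OF bij_A]
  by (simp_all add: R_def)

lemma R_A: "x \<in> D \<Longrightarrow> R (A x) = x"
  using bij_betw_inv_into_left[OF bij_A] by (simp add: R_def)

text \<open>The resolvent at 0 inverts -A, so it agrees with \<open>R\<close> up to a sign.\<close>

lemma R_continuous_linear: "continuous_linear sc sc R"
proof -
  define g L where "g = (\<lambda>x. sc 0 x - A x)" and "L = inv_into D g"
  have L: "continuous_linear sc sc L" and b: "bij_betw g D UNIV"
    using invertible unfolding resolvent_set_def L_def g_def by auto
  have R: "R x = L (- x)" for x
    using bij_betw_inv_into_left[OF b, of "R x"] by (simp add: L_def) (simp add: g_def)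
  then have "R = (\<lambda>x. - L x)" by (simp add: fun_eq_iff R continuous_linear_simps[OF L])
  then show ?thesis using L unfolding continuous_linear_iff
    by (auto intro: continuous_on_minus)
qed

lemmas R_simps = continuous_linear_simps[OF R_continuous_linear] continuous_linear_rscale[OF R_continuous_linear]

lemma R_eq_iff: "R x = R y \<longleftrightarrow> x = y"
  by (metis A_R)

text \<open>\<open>T t\<close> is continuous, linear and commutes with \<open>T h\<close>. So the
  difference quotients at \<open>T t (R x)\<close> are the images of those at \<open>R x\<close> and
  tend to \<open>T t x\<close>, which identifies \<open>A (T t (R x))\<close>.\<close>

lemma T_R:
  assumes "t \<ge> 0"
  shows "T t (R x) = R (T t x)"
proof -
  have "((\<lambda>h. (1 / h) *\<^sub>r (T h (T t (R x)) - T t (R x))) \<longlongrightarrow> T t x) (at_right 0)"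
  proof (rule Lim_transform_eventually)
    show "((\<lambda>h. T t ((1 / h) *\<^sub>r (T h (R x) - R x))) \<longlongrightarrow> T t x) (at_right 0)"
      using continuous_linear_tendsto[OF T_continuous_linear[OF assms] generatorD[OF R_in_D]] by simp
    have "T t ((1 / h) *\<^sub>r (T h (R x) - R x)) = (1 / h) *\<^sub>r (T h (T t (R x)) - T t (R x))" if "h > 0" for h
      using that assms T_add[of t h "R x"] T_add[of h t "R x"]
      by (simp add: T_simps(2,7) add.commute[of h t])
    then show "\<forall>\<^sub>F h in at_right 0. T t ((1 / h) *\<^sub>r (T h (R x) - R x)) = (1 / h) *\<^sub>r (T h (T t (R x)) - T t (R x))"
      by (auto simp: eventually_at_filter)
  qed
  from generatorI[OF this] show ?thesis using R_A by metis
qed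

lemma continuous_on_orbit: "0 \<le> a \<Longrightarrow> continuous_on {a..b} (\<lambda>s. T s x)"
  by (rule continuous_on_subset[OF T_orbit]) auto

text \<open>Applying \<open>T h\<close> shifts the interval of integration, so
  \<open>T h ?I - ?I\<close> reduces to integrals over short intervals at the two ends. Their
  averages converge, which puts the integral into \<open>D\<close> and gives its image under
  \<open>A\<close>.\<close>

lemma integ_orbit_0:
  assumes t: "t \<ge> 0"
  shows "integ 0 t (\<lambda>s. T s x) = R (T t x - x)"
proof -
  let ?f = "\<lambda>s. T s x" and ?I = "integ 0 t (\<lambda>s. T s x)"
  have "T h ?I - ?I = integ t (t + h) ?f - integ 0 (0 + h) ?f" if h: "h > 0" for h
  proof -
    have "has_integ 0 t (\<lambda>s. T h (T s x)) (T h ?I)"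
      using h by (intro has_riemann_integral_image[OF continuous_has_integ T_continuous_linear]
          continuous_on_orbit) auto
    then have "has_integ 0 t (\<lambda>s. ?f (s + h)) (T h ?I)"
      by (rule has_riemann_integral_cong) (use h T_add[of h _ x] in \<open>simp add: add.commute\<close>)
    then have "T h ?I = integ 0 t (\<lambda>s. ?f (s + h))" by (simp add: integ_eq)
    also have "\<dots> = integ (0 + h) (t + h) ?f"
      using t h by (intro integ_shift continuous_on_orbit) auto
    finally have "T h ?I = integ h (t + h) ?f" by simp
    moreover have "integ 0 (t + h) ?f = integ 0 h ?f + integ h (t + h) ?f"
      "integ 0 (t + h) ?f = ?I + integ t (t + h) ?f"
      using t h by (intro integ_combine continuous_on_orbit; simp)+
    ultimately show ?thesis by (simp add: algebra_simps)
  qed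
  then have eq: "\<forall>\<^sub>F h in at_right 0. (1 / h) *\<^sub>r integ t (t + h) ?f - (1 / h) *\<^sub>r integ 0 (0 + h) ?f
      = (1 / h) *\<^sub>r (T h ?I - ?I)"
    by (intro eventually_at_rightI[of 0 1]) (simp_all flip: rscale_right_diff)
  have "((\<lambda>h. (1 / h) *\<^sub>r integ t (t + h) ?f - (1 / h) *\<^sub>r integ 0 (0 + h) ?f)
      \<longlongrightarrow> T t x - T 0 x) (at_right 0)"
    using t by (intro tendsto_diff average_tendsto continuous_on_subset[OF T_orbit]) auto
  from generatorI[OF Lim_transform_eventually[OF this eq]] have "?I \<in> D" "A ?I = T t x - x"
    by (simp_all add: T_0)
  then show ?thesis using R_A by metis
qed

lemma integ_orbit:
  assumes "0 \<le> a" "a \<le> b"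
  shows "integ a b (\<lambda>s. T s x) = R (T b x - T a x)"
proof -
  have "integ 0 b (\<lambda>s. T s x) = integ 0 a (\<lambda>s. T s x) + integ a b (\<lambda>s. T s x)"
    using assms by (intro integ_combine continuous_on_orbit) auto
  then show ?thesis using assms by (simp add: integ_orbit_0 R_simps)
qed

text \<open>In the variable u = t - s the time of the semigroup is the variable of integration:
  freezing \<open>f\<close> on a cell leaves an orbit, whose integral \<open>integ_orbit\<close>
  gives exactly.\<close>

lemma convolution_eq:
  assumes f: "continuous_on {0..r} f" and t: "t \<in> {0..r}"
  shows "continuous_on {0..t} (\<lambda>s. T (t - s) (f s))"
    and "continuous_on {0..t} (\<lambda>u. T u (f (t - u)))"
    and "convolution sc T f t = integ 0 t (\<lambda>u. T u (f (t - u)))"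
proof -
  have ft: "continuous_on {0..t} f" by (rule continuous_on_subset[OF f]) (use t in auto)
  show c: "continuous_on {0..t} (\<lambda>s. T (t - s) (f s))"
    by (rule continuous_on_T_apply[where r = r]) (use t in \<open>auto intro!: continuous_intros ft\<close>)
  show "continuous_on {0..t} (\<lambda>u. T u (f (t - u)))"
    by (rule continuous_on_T_apply[where r = r])
       (use t in \<open>auto intro!: continuous_intros continuous_on_compose2[OF ft]\<close>)
  show "convolution sc T f t = integ 0 t (\<lambda>u. T u (f (t - u)))"
    unfolding convolution_def
    using integ_reflect[of t t 0 "\<lambda>s. T (t - s) (f s)"] c t by simp
qed

end


subsection \<open>Bounded semivariation implies maximal regularity\<close>

context lcs
begin

lemma continuous_on_uniform_limit:
  fixes h :: "'c::topological_space \<Rightarrow> 'a"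
  assumes g: "\<And>n::nat. continuous_on S (g n)"
    and lim: "\<And>q e. q \<in> \<Gamma> \<Longrightarrow> e > 0 \<Longrightarrow> \<exists>n. \<forall>t\<in>S. q (g n t - h t) < e"
  shows "continuous_on S h"
  unfolding continuous_on_def
proof (intro ballI tendsto_\<Gamma>I)
  fix s q and e :: real assume s: "s \<in> S" and q: "q \<in> \<Gamma>" and e: "e > 0"
  note sq = \<Gamma>_seminorm[OF q]
  obtain n where n: "\<And>t. t \<in> S \<Longrightarrow> q (g n t - h t) < e / 3"
    using lim[OF q, of "e / 3"] e by auto
  have "\<forall>\<^sub>F t in at s within S. q (g n t - g n s) < e / 3"
    using g[of n] s e q unfolding continuous_on_def by (intro tendsto_\<Gamma>D_less) auto
  moreover have "\<forall>\<^sub>F t in at s within S. t \<in> S"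
    by (auto simp: eventually_at_topological)
  ultimately show "\<forall>\<^sub>F t in at s within S. q (h t - h s) < e"
  proof eventually_elim
    case (elim t)
    have "q (h t - h s) \<le> q (h t - g n t) + (q (g n t - g n s) + q (g n s - h s))"
      using seminorm_diff_triangle[OF sq, of "h t" "h s" "g n t"] seminorm_diff_triangle[OF sq, of "g n t" "h s" "g n s"] by simp
    then show ?case
      using elim n[OF s] n[OF elim(2)] seminorm_minus_commute[OF sq, of "h t" "g n t"] by simp
  qed
qed

end

lemma increasing_nonneg:
  fixes d :: "nat \<Rightarrow> real"
  assumes "d 0 = 0" "\<And>i. i < n \<Longrightarrow> d i < d (Suc i)" "i \<le> n"
  shows "0 \<le> d i"
  using assms(3)
proof (induction i)
  case (Suc i)
  then show ?case using assms(2)[of i] by simp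
qed (simp add: assms(1))

section \<open>Variation sums and Stieltjes sums\<close>

context lcs_semigroup
begin

text \<open>The sums of \<open>semivariation\<close> with indices from 0: \<open>y i\<close> belongs
  to the cell between \<open>d i\<close> and \<open>d (Suc i)\<close>.\<close>

definition variation_sum :: "(nat \<Rightarrow> real) \<Rightarrow> nat \<Rightarrow> (nat \<Rightarrow> 'a) \<Rightarrow> 'a" where
  "variation_sum d n y = (\<Sum>i<n. T (d (Suc i)) (y i) - T (d i) (y i))"

text \<open>\<open>semivariation\<close> speaks of partitions of all of [0, r] and of vectors in the
  unit ball of \<open>p\<close>. Partitions that end earlier are prolonged, and other balls are
  reached by scaling. That \<open>K\<close> does not depend on \<open>t\<close> makes the later
  estimates uniform in time.\<close>

lemma variation_sum_bounded:
  assumes "bounded_semivariation \<Gamma> T r" "q \<in> \<Gamma>"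
  obtains p K where "p \<in> \<Gamma>" "K > 0"
    "\<And>n d y t \<eta>. d 0 = 0 \<Longrightarrow> d n = t \<Longrightarrow> t \<le> r \<Longrightarrow> (\<And>i. i < n \<Longrightarrow> d i < d (Suc i)) \<Longrightarrow>
      \<eta> > 0 \<Longrightarrow> (\<And>i. i < n \<Longrightarrow> p (y i) \<le> \<eta>) \<Longrightarrow> q (variation_sum d n y) \<le> K * \<eta>"
proof -
  obtain p where p: "p \<in> \<Gamma>" "semivariation q p T r < \<infinity>"
    using assms unfolding bounded_semivariation_def by blast
  note sp = \<Gamma>_seminorm[OF p(1)] and sq = \<Gamma>_seminorm[OF assms(2)]
  obtain K :: nat where K: "semivariation q p T r < ereal (real K)"
    using p(2) less_PInf_Ex_of_nat by fastforce
  have full: "q (variation_sum d n y) \<le> K"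
    if "d 0 = 0" "d n = r" "\<And>i. i < n \<Longrightarrow> d i < d (Suc i)" "\<And>i. i < n \<Longrightarrow> p (y i) \<le> 1" for d n y
  proof -
    have "ereal (q (\<Sum>i=1..n. T (d i) (y (i - 1)) - T (d (i - 1)) (y (i - 1)))) \<le> semivariation q p T r"
      unfolding semivariation_def
      by (intro Sup_upper CollectI exI[of _ n] exI[of _ d] exI[of _ "\<lambda>i. y (i - 1)"]) (use that in auto)
    also have "(\<Sum>i=1..n. T (d i) (y (i - 1)) - T (d (i - 1)) (y (i - 1))) = variation_sum d n y"
      unfolding variation_sum_def One_nat_def sum.atLeast1_atMost_eq by simp
    finally show ?thesis using K by (metis ereal_less_eq(3) less_imp_le order_trans)
  qed
  have unit: "q (variation_sum d n y) \<le> K"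
    if "d 0 = 0" "d n \<le> r" "\<And>i. i < n \<Longrightarrow> d i < d (Suc i)" "\<And>i. i < n \<Longrightarrow> p (y i) \<le> 1" for d n y
  proof (cases "d n = r")
    case False
    \<comment> \<open>One more cell, ending at \<open>r\<close>, carries the vector 0 and
      contributes nothing.\<close>
    define d' y' where "d' = d(Suc n := r)" and "y' = y(n := 0)"
    have "q (variation_sum d' (Suc n) y') \<le> K"
      by (rule full)
         (use that False in \<open>auto simp: d'_def y'_def less_Suc_eq seminorm_zero[OF sp] intro: le_neq_trans\<close>)
    also have "variation_sum d' (Suc n) y' = variation_sum d n y"
    proof -
      have "0 \<le> d n" by (rule increasing_nonneg[of d n]) (use that in auto)
      then have "T r 0 - T (d n) 0 = 0" using that(2) by (simp add: T_simps)
      then show ?thesis unfolding variation_sum_def by (simp add: d'_def y'_def)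
    qed
    finally show ?thesis .
  qed (use that full in blast)
  \<comment> \<open>The natural number \<open>K\<close> may be 0, while a positive constant is
    wanted.\<close>
  have "q (variation_sum d n y) \<le> (real K + 1) * \<eta>"
    if "d 0 = 0" "d n = t" "t \<le> r" "\<And>i. i < n \<Longrightarrow> d i < d (Suc i)" "\<eta> > 0" "\<And>i. i < n \<Longrightarrow> p (y i) \<le> \<eta>"
    for d n y t \<eta>
  proof -
    have nonneg: "0 \<le> d i" if "i \<le> n" for i
      by (rule increasing_nonneg[of d n]) (fact | fact that)+
    have "q (variation_sum d n (\<lambda>i. (1 / \<eta>) *\<^sub>r y i)) \<le> K"
      by (rule unit) (use that in \<open>auto simp: seminorm_rscale[OF sp] field_simps\<close>)
    also have "variation_sum d n (\<lambda>i. (1 / \<eta>) *\<^sub>r y i) = (1 / \<eta>) *\<^sub>r variation_sum d n y"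
      unfolding variation_sum_def rscale_sum_right
      by (intro sum.cong refl) (simp add: T_simps nonneg rscale_right_diff)
    finally have "q (variation_sum d n y) \<le> K * \<eta>"
      using that(5) by (simp add: seminorm_rscale[OF sq] field_simps)
    then show ?thesis using that(5) by (simp add: algebra_simps)
  qed
  then show ?thesis using that[of p "real K + 1"] p(1) by force
qed

text \<open>A Riemann--Stieltjes sum for \<open>A(T * f)(t) = \<integral>\<^bsub>[0,t]\<^esub> d(T(u)) f(t - u)\<close>.\<close>

definition stieltjes_sum :: "(real \<Rightarrow> 'a) \<Rightarrow> nat \<Rightarrow> real \<Rightarrow> 'a" where
  "stieltjes_sum f N t = variation_sum (\<lambda>i. i * t / N) N (\<lambda>i. f (t - i * t / N))"

text \<open>Each cell is cut into \<open>m\<close> equal parts that keep its vector, and the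
  increments of T telescope within the cell. The sums for \<open>N\<close> and \<open>N * m\<close>
  thus have the same nodes, so their difference is a variation sum with small vectors.\<close>

lemma stieltjes_sum_refine:
  assumes "N > 0" "m > 0"
  shows "stieltjes_sum f N t =
    variation_sum (\<lambda>k. k * t / real (N * m)) (N * m) (\<lambda>k. f (t - real (k div m) * t / N))"
proof -
  define y where "y = (\<lambda>i::nat. f (t - i * t / N))"
  define \<tau> where "\<tau> = (\<lambda>k::nat. k * t / real (N * m))"
  have "(\<Sum>k<N * m. T (\<tau> (Suc k)) (y (k div m)) - T (\<tau> k) (y (k div m))) =
      (\<Sum>i<N. \<Sum>k\<in>{i * m..<i * m + m}. T (\<tau> (Suc k)) (y (k div m)) - T (\<tau> k) (y (k div m)))"
    by (rule sum.nat_group[symmetric])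
  also have "\<dots> = (\<Sum>i<N. T (real (Suc i) * t / N) (y i) - T (i * t / N) (y i))"
  proof (rule sum.cong[OF refl])
    fix i
    have \<tau>: "\<tau> (i * m + m) = real (Suc i) * t / N" "\<tau> (i * m) = i * t / N"
      using assms by (simp_all add: \<tau>_def field_simps)
    have "k div m = i" if "k \<in> {i * m..<i * m + m}" for k
      using that by (intro div_nat_eqI) (auto simp: mult.commute)
    then have "(\<Sum>k\<in>{i * m..<i * m + m}. T (\<tau> (Suc k)) (y (k div m)) - T (\<tau> k) (y (k div m))) =
        (\<Sum>k\<in>{i * m..<i * m + m}. T (\<tau> (Suc k)) (y i) - T (\<tau> k) (y i))"
      by (intro sum.cong) auto
    also have "\<dots> = T (\<tau> (i * m + m)) (y i) - T (\<tau> (i * m)) (y i)"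
      by (rule sum_Suc_diff') simp
    finally show "(\<Sum>k\<in>{i * m..<i * m + m}. T (\<tau> (Suc k)) (y (k div m)) - T (\<tau> k) (y (k div m))) =
        T (real (Suc i) * t / N) (y i) - T (i * t / N) (y i)" unfolding \<tau> .
  qed
  finally show ?thesis
    unfolding stieltjes_sum_def variation_sum_def y_def \<tau>_def ..
qed

lemma stieltjes_sum_close:
  assumes sv: "bounded_semivariation \<Gamma> T r" and r: "r > 0" and f: "continuous_on {0..r} f"
    and q: "q \<in> \<Gamma>" and e: "e > 0"
  obtains N0 where "N0 > 0"
    "\<And>N m t. N \<ge> N0 \<Longrightarrow> m > 0 \<Longrightarrow> t \<in> {0..r} \<Longrightarrow> q (stieltjes_sum f (N * m) t - stieltjes_sum f N t) < e"
proof -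
  obtain p K where p: "p \<in> \<Gamma>" and K: "K > 0" "\<And>n d y t \<eta>. d 0 = 0 \<Longrightarrow> d n = t \<Longrightarrow> t \<le> r \<Longrightarrow>
      (\<And>i. i < n \<Longrightarrow> d i < d (Suc i)) \<Longrightarrow> \<eta> > 0 \<Longrightarrow> (\<And>i. i < n \<Longrightarrow> p (y i) \<le> \<eta>) \<Longrightarrow>
      q (variation_sum d n y) \<le> K * \<eta>"
    using variation_sum_bounded[OF sv q] by metis
  define \<eta> where "\<eta> = e / (2 * K)"
  have \<eta>: "\<eta> > 0" "K * \<eta> < e" using e K(1) by (auto simp: \<eta>_def)
  obtain \<delta> where \<delta>: "\<delta> > 0"
    "\<And>s t. s \<in> {0..r} \<Longrightarrow> t \<in> {0..r} \<Longrightarrow> \<bar>s - t\<bar> < \<delta> \<Longrightarrow> p (f s - f t) < \<eta>"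
    using uniformly_continuous_\<Gamma>[OF f p \<eta>(1)] by metis
  \<comment> \<open>The mesh \<open>t / N\<close> is at most \<open>r / N\<close>, so
    \<open>N0\<close> can be chosen independently of \<open>t\<close>.\<close>
  obtain N0 :: nat where N0: "r / \<delta> < N0" using reals_Archimedean2 by blast
  then have "N0 > 0" using r \<delta>(1) by (metis divide_pos_pos of_nat_0_less_iff order_less_trans)
  moreover have "q (stieltjes_sum f (N * m) t - stieltjes_sum f N t) < e"
    if N: "N \<ge> N0" and m: "m > 0" and t: "t \<in> {0..r}" for N m t
  proof (cases "t = 0")
    case True
    \<comment> \<open>All nodes coincide at time 0. They form no partition, but all increments
      vanish.\<close>
    then have "stieltjes_sum f M t = 0" for M
      by (simp add: stieltjes_sum_def variation_sum_def)
    then show ?thesis using e by (simp add: seminorm_zero[OF \<Gamma>_seminorm[OF q]])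
  next
    case False
    then have t0: "t > 0" using t by simp
    have N1: "N > 0" "r / N < \<delta>"
    proof -
      show "N > 0" using N \<open>N0 > 0\<close> by simp
      have "r < \<delta> * N0" using N0 \<delta>(1) by (simp add: field_simps)
      also have "\<dots> \<le> \<delta> * N" using N \<delta>(1) by simp
      finally show "r / N < \<delta>" using \<open>N > 0\<close> by (simp add: field_simps)
    qed
    define d where "d = (\<lambda>k::nat. k * t / real (N * m))"
    define y where "y = (\<lambda>k. f (t - d k) - f (t - real (k div m) * t / N))"
    have "p (y k) \<le> \<eta>" if k: "k < N * m" for k
    proof -
      have "real k = real (k div m) * m + real (k mod m)"
        by (metis div_mult_mod_eq of_nat_add of_nat_mult)
      \<comment> \<open>The fine node lies the fraction (k mod m) / m of a coarse cell beyond the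
        node that supplies the vector of the coarse sum.\<close>
      then have dk: "d k - real (k div m) * t / N = real (k mod m) / m * (t / N)"
        using N1 m by (simp add: d_def field_simps)
      have frac: "0 \<le> real (k mod m) / m" "real (k mod m) / m < 1" using m by auto
      have "real (k mod m) / m * (t / N) < \<delta>"
      proof -
        have "real (k mod m) / m * (t / N) \<le> 1 * (r / N)"
          using frac t N1 by (intro mult_mono divide_right_mono) auto
        then show ?thesis using N1(2) by simp
      qed
      moreover have "0 \<le> real (k mod m) / m * (t / N)" using frac t0 by simp
      moreover have "0 \<le> real (k div m) * t / N" using t0 by simp
      moreover have "d k \<le> t"
      proof -
        have "real k * t \<le> real (N * m) * t" using k t0 by (intro mult_right_mono of_nat_mono) auto
        then show ?thesis using N1 m by (simp add: d_def field_simps)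
      qed
      ultimately show ?thesis
        unfolding y_def using dk t by (intro less_imp_le[OF \<delta>(2)]) auto
    qed
    moreover have "d i < d (Suc i)" for i
      using t0 N1 m by (simp add: d_def divide_strict_right_mono)
    ultimately have "q (variation_sum d (N * m) y) \<le> K * \<eta>"
      using t N1 m by (intro K(2)[OF _ refl] \<eta>(1)) (auto simp: d_def)
    also have "variation_sum d (N * m) y = stieltjes_sum f (N * m) t - stieltjes_sum f N t"
    proof -
      have "T u (a - b) - T v (a - b) = (T u a - T v a) - (T u b - T v b)" if "0 \<le> u" "0 \<le> v" for a b u v
        using that by (simp add: T_simps algebra_simps)
      then show ?thesis
        unfolding stieltjes_sum_refine[OF N1(1) m]
        unfolding stieltjes_sum_def variation_sum_def y_def d_def sum_subtractf[symmetric]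
        using t0 by (intro sum.cong refl) auto
    qed
    finally show ?thesis using \<eta>(2) by simp
  qed
  ultimately show ?thesis using that by blast
qed

lemma continuous_on_stieltjes_sum:
  assumes "continuous_on {0..r} f" "r \<ge> 0"
  shows "continuous_on {0..r} (stieltjes_sum f N)"
proof -
  \<comment> \<open>For \<open>N = 0\<close> only \<open>i = 0\<close> occurs, and division by 0
    yields the node 0.\<close>
  have le: "i * t / N \<le> t" if "i \<le> N" "0 \<le> t" for i N :: nat and t :: real
    using that by (cases "N = 0") (auto simp: field_simps intro!: mult_left_mono)
  have lin: "continuous_on {0..r} (\<lambda>t. k * t / N)" for k :: nat
    by (cases "N = 0") (auto intro!: continuous_intros)
  have g: "continuous_on {0..r} (\<lambda>t. f (t - i * t / N))" if "i \<le> N" for i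
  proof (rule continuous_on_compose2[OF assms(1)])
    have "t - i * t / N \<in> {0..r}" if "t \<in> {0..r}" for t :: real
    proof -
      have "0 \<le> i * t / N" using that by simp
      then show ?thesis using le[OF \<open>i \<le> N\<close>, of t] that unfolding atLeastAtMost_iff by linarith
    qed
    then show "(\<lambda>t. t - i * t / N) ` {0..r} \<subseteq> {0..r}" by blast
  qed (intro continuous_on_diff continuous_on_id lin)
  have "continuous_on {0..r} (\<lambda>t. T (k * t / N) (f (t - i * t / N)))" if "i \<le> N" "k \<le> N" for i k
  proof (rule continuous_on_T_apply[where r = r])
    have "k * t / N \<in> {0..r}" if "t \<in> {0..r}" for t :: real
    proof -
      have "0 \<le> k * t / N" using that by simp
      then show ?thesis using le[OF \<open>k \<le> N\<close>, of t] that unfolding atLeastAtMost_iff by linarith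
    qed
    then show "(\<lambda>t. k * t / N) ` {0..r} \<subseteq> {0..r}" by blast
  qed (intro lin g that(1))+
  then show ?thesis
    unfolding stieltjes_sum_def[abs_def] variation_sum_def
    by (intro continuous_on_sum_lcs continuous_on_diff) (simp_all del: of_nat_Suc)
qed

text \<open>Replace f(t - u) by its value at the left node of each cell. The integral of the
  resulting orbit is R of an increment, and the error is controlled by equicontinuity and uniform
  continuity of \<open>f\<close>.\<close>

lemma R_stieltjes_sum_tendsto:
  assumes f: "continuous_on {0..r} f" and t: "t \<in> {0..r}"
  shows "(\<lambda>N. R (stieltjes_sum f N t)) \<longlonglongrightarrow> convolution sc T f t"
proof (rule tendsto_\<Gamma>I)
  fix q and e :: real assume q: "q \<in> \<Gamma>" and e: "e > 0"
  obtain p M where p: "p \<in> \<Gamma>" and M: "M > 0" "\<And>t x. t \<in> {0..r} \<Longrightarrow> q (T t x) \<le> M * p x"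
    using T_bounded[OF q] by metis
  \<comment> \<open>The error over [0, t] will be \<open>M * \<eta> * t\<close>; using
    \<open>t + 1\<close> covers \<open>t = 0\<close>.\<close>
  define \<eta> where "\<eta> = e / (M * (t + 1))"
  have \<eta>: "\<eta> > 0" "M * \<eta> * t < e"
  proof -
    show "\<eta> > 0" using e M t by (simp add: \<eta>_def)
    have "M * \<eta> * t = e * t / (t + 1)" using M by (simp add: \<eta>_def)
    then show "M * \<eta> * t < e" using e t by (simp add: pos_divide_less_eq)
  qed
  obtain \<delta> where \<delta>: "\<delta> > 0"
    "\<And>s t. s \<in> {0..r} \<Longrightarrow> t \<in> {0..r} \<Longrightarrow> \<bar>s - t\<bar> < \<delta> \<Longrightarrow> p (f s - f t) < \<eta>"
    using uniformly_continuous_\<Gamma>[OF f p \<eta>(1)] by metis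
  have "(\<lambda>N. t / real N) \<longlonglongrightarrow> 0" by (rule lim_const_over_n)
  then have "\<forall>\<^sub>F N in sequentially. t / real N < \<delta>" using \<delta>(1) order_tendstoD(2) by blast
  then show "\<forall>\<^sub>F N in sequentially. q (R (stieltjes_sum f N t) - convolution sc T f t) < e"
    using eventually_gt_at_top[of 0]
  proof eventually_elim
    case (elim N)
    define c where "c = (\<lambda>i::nat. i * t / N)"
    have c: "c 0 = 0" "c N = t" "\<And>i. c (Suc i) = c i + t / N" "\<And>i. 0 \<le> c i"
      using elim t by (auto simp: c_def field_simps)
    have ct: "c i \<le> t" if "i \<le> N" for i
      using elim that t by (simp add: c_def field_simps mult_left_mono)
    have "q (integ (c 0) (c N) (\<lambda>u. T u (f (t - u))) -
        (\<Sum>i<N. R (T (c (Suc i)) (f (t - c i)) - T (c i) (f (t - c i))))) \<le> M * \<eta> * (c N - c 0)"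
    proof (rule integ_approx_pieces[where g = "\<lambda>i u. T u (f (t - c i))"])
      show "continuous_on {c 0..c N} (\<lambda>u. T u (f (t - u)))"
        using convolution_eq(2)[OF f t] c by simp
      show le: "c i \<le> c (Suc i)" for i using c t by simp
      show "has_integ (c i) (c (Suc i)) (\<lambda>u. T u (f (t - c i)))
          (R (T (c (Suc i)) (f (t - c i)) - T (c i) (f (t - c i))))" for i
        using continuous_has_integ[OF continuous_on_orbit] integ_orbit c(4) le by metis
      show "q (T s (f (t - s)) - T s (f (t - c i))) \<le> M * \<eta>" if "i < N" "s \<in> {c i..c (Suc i)}" for i s
      proof -
        have s: "0 \<le> s" "s \<le> t" "c i \<le> t" "\<bar>t - s - (t - c i)\<bar> < \<delta>"
          using that ct[of "Suc i"] ct[of i] c(3,4)[of i] elim by auto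
        then have "p (f (t - s) - f (t - c i)) < \<eta>" using t c(4)[of i] by (intro \<delta>(2)) auto
        then have "M * p (f (t - s) - f (t - c i)) \<le> M * \<eta>" using M(1) by simp
        then show ?thesis
          using M(2)[of s "f (t - s) - f (t - c i)"] s t by (simp add: T_simps)
      qed
    qed (rule q)
    also have "(\<Sum>i<N. R (T (c (Suc i)) (f (t - c i)) - T (c i) (f (t - c i)))) = R (stieltjes_sum f N t)"
      unfolding stieltjes_sum_def variation_sum_def c_def by (simp only: R_simps)
    also have "integ (c 0) (c N) (\<lambda>u. T u (f (t - u))) = convolution sc T f t"
      using convolution_eq(3)[OF f t] c by simp
    finally show ?case
      using c \<eta>(2) seminorm_minus_commute[OF \<Gamma>_seminorm[OF q]] by simp
  qed
qed

theorem bounded_semivariation_imp_maximal_regularity: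
  assumes sv: "bounded_semivariation \<Gamma> T r" and r: "r > 0"
  shows "C_maximal_regularity sc T r"
  unfolding C_maximal_regularity_def
proof (intro allI impI)
  fix f :: "real \<Rightarrow> 'a" assume f: "continuous_on {0..r} f"
  let ?z = "stieltjes_sum f"
  have cauchy: "\<exists>N0>0. \<forall>N\<ge>N0. \<forall>M\<ge>N0. \<forall>t\<in>{0..r}. q (?z N t - ?z M t) < e" if q: "q \<in> \<Gamma>" and e: "e > 0" for q e
  proof -
    note sq = \<Gamma>_seminorm[OF q]
    obtain N0 where N0: "N0 > 0"
      "\<And>N m t. N \<ge> N0 \<Longrightarrow> m > 0 \<Longrightarrow> t \<in> {0..r} \<Longrightarrow> q (?z (N * m) t - ?z N t) < e / 2"
      using stieltjes_sum_close[OF sv r f q, of "e / 2"] e by auto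
    \<comment> \<open>The sum for \<open>N * M\<close> refines both and lies within
      \<open>e / 2\<close> of each.\<close>
    have "q (?z N t - ?z M t) < e" if "N \<ge> N0" "M \<ge> N0" "t \<in> {0..r}" for N M t
      using N0(2)[of N M t] N0(2)[of M N t] that N0(1) seminorm_diff_triangle[OF sq, of "?z N t" "?z M t" "?z (N * M) t"]
        seminorm_minus_commute[OF sq, of "?z N t" "?z (N * M) t"]
      by (simp add: mult.commute)
    then show ?thesis using N0(1) by blast
  qed
  have "\<exists>l. (\<lambda>N. ?z N t) \<longlonglongrightarrow> l" if t: "t \<in> {0..r}" for t
  proof -
    have "\<exists>P. eventually P sequentially \<and> (\<forall>N M. P N \<longrightarrow> P M \<longrightarrow> q (?z N t - ?z M t) < e)"
      if "q \<in> \<Gamma>" "e > 0" for q e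
      using cauchy[OF that] t eventually_ge_at_top by metis
    then show ?thesis using tendsto_Cauchy[of sequentially "\<lambda>N. ?z N t"] by (metis sequentially_bot)
  qed
  then obtain z where z: "\<And>t. t \<in> {0..r} \<Longrightarrow> (\<lambda>N. ?z N t) \<longlonglongrightarrow> z t" by metis
  have "continuous_on {0..r} z"
  proof (rule continuous_on_uniform_limit)
    show "continuous_on {0..r} (?z N)" for N
      using continuous_on_stieltjes_sum f r by simp
    fix q and e :: real assume q: "q \<in> \<Gamma>" and e: "e > 0"
    note sq = \<Gamma>_seminorm[OF q]
    have "e / 2 > 0" using e by simp
    from cauchy[OF q this] obtain N0 where
      N0: "\<And>N M t. N \<ge> N0 \<Longrightarrow> M \<ge> N0 \<Longrightarrow> t \<in> {0..r} \<Longrightarrow> q (?z N t - ?z M t) < e / 2"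
      by blast
    \<comment> \<open>Let M tend to infinity in the Cauchy estimate; \<open>N0\<close> does not
      depend on \<open>t\<close>.\<close>
    have "q (?z N0 t - z t) \<le> e / 2" if t: "t \<in> {0..r}" for t
    proof (rule tendsto_upperbound)
      show "(\<lambda>M. q (?z N0 t - ?z M t)) \<longlonglongrightarrow> q (?z N0 t - z t)"
        by (intro tendsto_seminorm[OF \<Gamma>_continuous[OF q]] tendsto_diff tendsto_const z t)
      show "\<forall>\<^sub>F M in sequentially. q (?z N0 t - ?z M t) \<le> e / 2"
        using eventually_ge_at_top[of N0] by eventually_elim (use N0 t in \<open>auto intro: less_imp_le\<close>)
    qed simp
    then show "\<exists>N. \<forall>t\<in>{0..r}. q (?z N t - z t) < e" using e by (intro exI[of _ N0]) force
  qed
  \<comment> \<open>Continuity of \<open>R\<close> lets the limit pass, so no limit is taken under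
    \<open>A\<close>; membership in \<open>D\<close> and the value \<open>z t\<close> of
    \<open>A\<close> can then be read off.\<close>
  moreover have conv: "convolution sc T f t = R (z t)" if "t \<in> {0..r}" for t
    using LIMSEQ_unique R_stieltjes_sum_tendsto[OF f that]
      continuous_linear_tendsto[OF R_continuous_linear z[OF that]] by blast
  ultimately show "(\<forall>t\<in>{0..r}. convolution sc T f t \<in> D) \<and>
      continuous_on {0..r} (\<lambda>t. A (convolution sc T f t))"
    by (simp cong: continuous_on_cong_simp)
qed

end


subsection \<open>Continuity of the convolution implies bounded semivariation\<close>

lemma topspace_seminorm_topology: "topspace (seminorm_topology V P) = V"
proof (rule antisym)
  show "topspace (seminorm_topology V P) \<subseteq> V"
    using openin_topspace[of "seminorm_topology V P"] unfolding openin_seminorm_topology by blast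
  have "openin (seminorm_topology V P) V"
    unfolding openin_seminorm_topology by (auto intro!: exI[of _ "{}"] intro: zero_less_one)
  then show "V \<subseteq> topspace (seminorm_topology V P)" by (rule openin_subset)
qed

text \<open>As \<delta> decreases to 0 this tends to the indicator function of the positive
  half-line.\<close>

definition ramp :: "real \<Rightarrow> real \<Rightarrow> real" where
  "ramp \<delta> u = max 0 (min 1 (u / \<delta>))"

lemma ramp_bounds: "0 \<le> ramp \<delta> u" "ramp \<delta> u \<le> 1"
  by (auto simp: ramp_def)

lemma ramp_eq: "\<delta> > 0 \<Longrightarrow> u \<le> 0 \<Longrightarrow> ramp \<delta> u = 0" "\<delta> > 0 \<Longrightarrow> u \<ge> \<delta> \<Longrightarrow> ramp \<delta> u = 1"
  by (auto simp: ramp_def divide_nonpos_pos min_def max_def field_simps)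

lemma ramp_mono: "\<delta> > 0 \<Longrightarrow> u \<le> v \<Longrightarrow> ramp \<delta> u \<le> ramp \<delta> v"
  unfolding ramp_def by (intro max.mono min.mono divide_right_mono) auto

lemma continuous_on_ramp [continuous_intros]:
  "\<delta> > 0 \<Longrightarrow> continuous_on S f \<Longrightarrow> continuous_on S (\<lambda>u. ramp \<delta> (f u))"
  unfolding ramp_def by (intro continuous_intros) auto

section \<open>Testing the 3C property on smoothed step functions\<close>

context lcs_semigroup
begin

lemma convolution_rscale:
  assumes "continuous_on {0..r} f" "t \<in> {0..r}"
  shows "convolution sc T (\<lambda>s. c *\<^sub>r f s) t = c *\<^sub>r convolution sc T f t"
proof -
  have "has_integ 0 t (\<lambda>u. T u (f (t - u))) (convolution sc T f t)"
    using continuous_has_integ[OF convolution_eq(2)[OF assms]] convolution_eq(3)[OF assms] by simp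
  then have "has_integ 0 t (\<lambda>u. c *\<^sub>r T u (f (t - u))) (c *\<^sub>r convolution sc T f t)"
    by (rule has_integ_rscale)
  then have "has_integ 0 t (\<lambda>u. T u (c *\<^sub>r f (t - u))) (c *\<^sub>r convolution sc T f t)"
    by (rule has_riemann_integral_cong) (simp add: T_simps)
  moreover have "continuous_on {0..r} (\<lambda>s. c *\<^sub>r f s)"
    by (intro continuous_on_rscale continuous_intros assms)
  ultimately show ?thesis using convolution_eq(3)[OF _ assms(2)] by (simp add: integ_eq)
qed

text \<open>Continuity at the zero function gives a neighbourhood on which \<open>q\<close> of the
  image is below 1. The finitely many sup-seminorms that define it are dominated by one
  \<open>p\<close>, and homogeneity spreads the bound to the unit ball.\<close>

lemma three_C_bound:
  assumes three: "three_C_space sc \<Gamma> T r" and r: "r > 0"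
    and dom: "\<And>f. continuous_on {0..r} f \<Longrightarrow> convolution sc T f r \<in> D"
    and q: "q \<in> \<Gamma>"
  obtains p C where "p \<in> \<Gamma>" "\<And>f. continuous_on {0..r} f \<Longrightarrow> (\<And>s. s \<in> {0..r} \<Longrightarrow> p (f s) \<le> 1) \<Longrightarrow>
    q (A (convolution sc T f r)) \<le> C"
proof -
  define V where "V = {f :: real \<Rightarrow> 'a. continuous_on {0..r} f}"
  define G where "G = (\<lambda>f. A (convolution sc T f r))"
  define S where "S = (\<lambda>(p :: 'a \<Rightarrow> real) (f :: real \<Rightarrow> 'a). SUP s\<in>{0..r}. p (f s))"
  \<comment> \<open>Homogeneity holds for the convolution, that is for \<open>R\<close> after
    \<open>G\<close>, and \<open>R\<close> is injective.\<close>
  have G_rscale: "G (\<lambda>s. c *\<^sub>r f s) = c *\<^sub>r G f" if "f \<in> V" for c f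
  proof -
    have "f \<in> V \<Longrightarrow> R (G f) = convolution sc T f r" for f
      unfolding G_def V_def by (simp add: R_A dom)
    moreover have "(\<lambda>s. c *\<^sub>r f s) \<in> V"
      using that unfolding V_def by (auto intro!: continuous_on_rscale continuous_intros)
    ultimately have "R (G (\<lambda>s. c *\<^sub>r f s)) = R (c *\<^sub>r G f)"
      using that convolution_rscale[of r f r c] r unfolding V_def by (simp add: R_simps)
    then show ?thesis by (simp add: R_eq_iff)
  qed
  have c1: "continuous_map (seminorm_topology V (S ` \<Gamma>)) euclidean G"
    using three dom unfolding three_C_space_def C_space_topology_def V_def G_def S_def by blast
  have c2: "openin euclidean {y. q y < 1}"
    by (rule open_openin[THEN iffD1, OF open_Collect_less[OF \<Gamma>_continuous[OF q] continuous_on_const]])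
  have "openin (seminorm_topology V (S ` \<Gamma>)) {f \<in> V. q (G f) < 1}"
    using openin_continuous_map_preimage[OF c1 c2] unfolding topspace_seminorm_topology by simp
  moreover have zero: "(\<lambda>_. 0) \<in> {f \<in> V. q (G f) < 1}"
    using G_rscale[of "\<lambda>_. 0" 0] by (simp add: V_def seminorm_zero[OF \<Gamma>_seminorm[OF q]])
  ultimately obtain F e where F: "finite F" "F \<subseteq> S ` \<Gamma>" "e > 0"
    "{f \<in> V. \<forall>P\<in>F. P (f - (\<lambda>_. 0)) < e} \<subseteq> {f \<in> V. q (G f) < 1}"
    unfolding openin_seminorm_topology by blast
  obtain F0 where F0: "finite F0" "F0 \<subseteq> \<Gamma>" "F = S ` F0"
    using finite_subset_image[OF F(1,2)] by blast
  obtain p C where p: "p \<in> \<Gamma>" "C \<ge> 0" "\<And>q x. q \<in> F0 \<Longrightarrow> q x \<le> C * p x"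
    using dominated_finite[of F0] F0 \<Gamma>_seminorm \<Gamma>_continuous by blast
  \<comment> \<open>Scaling by \<open>\<eta>\<close> moves the unit ball of \<open>p\<close> into
    the neighbourhood.\<close>
  define \<eta> where "\<eta> = e / (C + 1)"
  have \<eta>: "\<eta> > 0" "\<eta> * C < e" using F(3) p(2) by (auto simp: \<eta>_def field_simps add_pos_nonneg)
  have "q (G f) \<le> 1 / \<eta>" if f: "continuous_on {0..r} f" "\<And>s. s \<in> {0..r} \<Longrightarrow> p (f s) \<le> 1" for f
  proof -
    have "S p' ((\<lambda>s. \<eta> *\<^sub>r f s) - (\<lambda>_. 0)) < e" if p': "p' \<in> F0" for p'
    proof -
      have "S p' ((\<lambda>s. \<eta> *\<^sub>r f s) - (\<lambda>_. 0)) \<le> \<eta> * C"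
        unfolding S_def
      proof (rule cSUP_least)
        fix s assume s: "s \<in> {0..r}"
        have "p' (f s) \<le> C * p (f s)" by (rule p(3)[OF p'])
        also have "\<dots> \<le> C * 1" by (intro mult_left_mono f(2) s p(2))
        finally show "p' (((\<lambda>s. \<eta> *\<^sub>r f s) - (\<lambda>_. 0)) s) \<le> \<eta> * C"
          using \<eta>(1) p' F0(2) \<Gamma>_seminorm by (auto simp: seminorm_rscale)
      qed (use r in auto)
      then show ?thesis using \<eta>(2) by simp
    qed
    moreover have fV: "f \<in> V" "(\<lambda>s. \<eta> *\<^sub>r f s) \<in> V"
      using f(1) unfolding V_def by (auto intro!: continuous_on_rscale continuous_intros)
    ultimately have "q (G (\<lambda>s. \<eta> *\<^sub>r f s)) < 1" using F(4) F0(3) by blast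
    then show ?thesis
      using \<eta>(1) by (simp add: G_rscale[OF fV(1)] seminorm_rscale[OF \<Gamma>_seminorm[OF q]] field_simps)
  qed
  then show ?thesis using that p(1) unfolding G_def by blast
qed

text \<open>The ramp is 0 up to \<open>c\<close> and 1 from \<open>c + \<delta>\<close> on. Compared
  with the integral of the orbit over [c, r], the error arises on an interval of length at most
  \<open>\<delta>\<close>, where it is bounded.\<close>

lemma integ_ramp_tendsto:
  assumes c: "c \<in> {0..r}"
  shows "((\<lambda>\<delta>. integ 0 r (\<lambda>u. ramp \<delta> (u - c) *\<^sub>r T u y)) \<longlongrightarrow> R (T r y - T c y)) (at_right 0)"
proof (rule tendsto_\<Gamma>I_zero)
  fix p assume p: "p \<in> \<Gamma>"
  note sp = \<Gamma>_seminorm[OF p]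
  obtain p' M where M: "M > 0" "\<And>t x. t \<in> {0..r} \<Longrightarrow> p (T t x) \<le> M * p' x"
    using T_bounded[OF p] by metis
  define B where "B = M * p' y"
  have "p (integ 0 r (\<lambda>u. ramp \<delta> (u - c) *\<^sub>r T u y) - R (T r y - T c y)) \<le> B * \<delta>" if \<delta>: "\<delta> > 0" for \<delta>
  proof -
    define F where "F = (\<lambda>u. ramp \<delta> (u - c) *\<^sub>r T u y)"
    \<comment> \<open>The ramp may still be rising at \<open>r\<close>, hence the cut-off.\<close>
    define c' where "c' = min (c + \<delta>) r"
    have c': "c \<le> c'" "c' \<le> r" "c' - c \<le> \<delta>" using c \<delta> by (auto simp: c'_def)
    have F: "continuous_on {a..b} F" if "0 \<le> a" for a b
      unfolding F_def by (intro continuous_on_rscale continuous_on_orbit that continuous_intros \<delta>)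
    have "integ 0 r F = integ 0 c F + (integ c c' F + integ c' r F)"
      using integ_combine[OF F, of 0 c r] integ_combine[OF F, of c c' r] c c' by simp
    moreover have "integ 0 c F = 0"
    proof -
      have "has_integ 0 c F 0"
        by (rule has_riemann_integral_cong[OF has_integ_const[of 0 c 0, simplified]])
           (use c \<delta> in \<open>auto simp: F_def ramp_eq\<close>)
      then show ?thesis by (rule integ_eq)
    qed
    moreover have "integ c' r F = R (T r y - T c' y)"
    proof -
      have hi: "has_integ c' r (\<lambda>u. T u y) (R (T r y - T c' y))"
        using continuous_has_integ[OF continuous_on_orbit, of c' r y] integ_orbit[of c' r y] c c' by simp
      have "has_integ c' r F (R (T r y - T c' y))"
      proof (cases "c' = r")
        case True
        have "has_integ r r F 0"
          using continuous_has_integ[OF F, of r r] c by (simp add: integ_empty)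
        then show ?thesis using True by (simp add: R_simps)
      next
        case False
        then have "c' = c + \<delta>" by (auto simp: c'_def)
        then show ?thesis
          by (intro has_riemann_integral_cong[OF hi]) (auto simp: F_def ramp_eq \<delta>)
      qed
      then show ?thesis by (rule integ_eq)
    qed
    ultimately have eq: "integ 0 r F - R (T r y - T c y) = integ c c' F - R (T c' y - T c y)"
      by (simp add: R_simps)
    have "has_integ c c' (\<lambda>u. F u - T u y) (integ c c' F - R (T c' y - T c y))"
      using continuous_has_integ[OF continuous_on_orbit, of c c' y] integ_orbit[of c c' y] c c'
      by (intro has_integ_diff continuous_has_integ F) auto
    then have "p (integ c c' F - R (T c' y - T c y)) \<le> B * (c' - c)"
    proof (rule has_integ_le[OF _ c'(1) p])
      fix u assume u: "u \<in> {c..c'}"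
      have "F u - T u y = (ramp \<delta> (u - c) - 1) *\<^sub>r T u y" by (simp add: F_def rscale_left_diff)
      then have "p (F u - T u y) = \<bar>ramp \<delta> (u - c) - 1\<bar> * p (T u y)" by (simp add: seminorm_rscale[OF sp])
      also have "\<dots> \<le> 1 * p (T u y)"
        using ramp_bounds[of \<delta> "u - c"] by (intro mult_right_mono seminorm_nonneg[OF sp]) auto
      also have "\<dots> \<le> B" using M(2)[of u y] u c c' by (auto simp: B_def)
      finally show "p (F u - T u y) \<le> B" .
    qed
    also have "\<dots> \<le> B * \<delta>"
    proof (rule mult_left_mono[OF c'(3)])
      have "0 \<le> p (T c y)" by (rule seminorm_nonneg[OF sp])
      then show "0 \<le> B" using M(2)[OF c, of y] by (simp add: B_def)
    qed
    finally show ?thesis using eq by (simp add: F_def)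
  qed
  then have "\<forall>\<^sub>F \<delta> in at_right 0. p (integ 0 r (\<lambda>u. ramp \<delta> (u - c) *\<^sub>r T u y) - R (T r y - T c y)) \<le> B * \<delta>"
    by (intro eventually_at_rightI[of 0 1]) auto
  moreover have "((\<lambda>\<delta>. B * \<delta>) \<longlongrightarrow> B * 0) (at_right 0)" by (intro tendsto_intros)
  ultimately show "((\<lambda>\<delta>. p (integ 0 r (\<lambda>u. ramp \<delta> (u - c) *\<^sub>r T u y) - R (T r y - T c y))) \<longlongrightarrow> 0) (at_right 0)"
    by - (rule real_tendsto_sandwich[OF _ _ tendsto_const[of 0]], auto simp: seminorm_nonneg[OF sp])
qed

text \<open>
  A continuous approximation of the step function that equals \<open>x i\<close> on \<open>{d i<..<d (Suc i)}\<close>. The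
  weights of the \<open>x i\<close> are nonnegative and telescope to at most 1.
\<close>

definition smoothed_step :: "(nat \<Rightarrow> real) \<Rightarrow> nat \<Rightarrow> (nat \<Rightarrow> 'a) \<Rightarrow> real \<Rightarrow> real \<Rightarrow> 'a" where
  "smoothed_step d n x \<delta> u = (\<Sum>i<n. (ramp \<delta> (u - d i) - ramp \<delta> (u - d (Suc i))) *\<^sub>r x i)"

lemma continuous_on_smoothed_step: "\<delta> > 0 \<Longrightarrow> continuous_on S (smoothed_step d n x \<delta>)"
  unfolding smoothed_step_def[abs_def]
  by (intro continuous_on_sum_lcs continuous_on_rscale continuous_intros)

lemma smoothed_step_le:
  assumes "\<delta> > 0" "seminorm sc p" "\<And>i. i < n \<Longrightarrow> d i \<le> d (Suc i)" "\<And>i. i < n \<Longrightarrow> p (x i) \<le> 1"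
  shows "p (smoothed_step d n x \<delta> u) \<le> 1"
proof -
  let ?w = "\<lambda>i. ramp \<delta> (u - d i) - ramp \<delta> (u - d (Suc i))"
  have w: "0 \<le> ?w i" if "i < n" for i
    using ramp_mono[OF assms(1), of "u - d (Suc i)" "u - d i"] assms(3)[OF that] by simp
  have "p (smoothed_step d n x \<delta> u) \<le> (\<Sum>i<n. p (?w i *\<^sub>r x i))"
    unfolding smoothed_step_def by (rule seminorm_sum[OF assms(2)])
  also have "\<dots> \<le> (\<Sum>i<n. ?w i)"
  proof (rule sum_mono)
    fix i assume "i \<in> {..<n}"
    then show "p (?w i *\<^sub>r x i) \<le> ?w i"
      using w[of i] assms(4)[of i] mult_left_mono[of "p (x i)" 1 "?w i"] by (simp add: seminorm_rscale[OF assms(2)])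
  qed
  also have "\<dots> = ramp \<delta> (u - d 0) - ramp \<delta> (u - d n)"
    by (rule sum_lessThan_telescope')
  also have "\<dots> \<le> 1" using ramp_bounds[of \<delta> "u - d 0"] ramp_bounds[of \<delta> "u - d n"] by simp
  finally show ?thesis .
qed

text \<open>The step function is prescribed in u = r - s, where the convolution integrates T(u). The
  ramps at the two ends of a cell produce limits in which the terms with \<open>T r\<close> cancel,
  leaving one increment of T.\<close>

lemma convolution_smoothed_step_tendsto:
  assumes r: "r > 0" and d: "\<And>i. i \<le> n \<Longrightarrow> d i \<in> {0..r}"
  shows "((\<lambda>\<delta>. convolution sc T (\<lambda>s. smoothed_step d n x \<delta> (r - s)) r) \<longlongrightarrow> R (variation_sum d n x))
    (at_right 0)"
proof -
  define J where "J = (\<lambda>\<delta> c y. integ 0 r (\<lambda>u. ramp \<delta> (u - c) *\<^sub>r T u y))"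
  have "((\<lambda>\<delta>. \<Sum>i<n. J \<delta> (d i) (x i) - J \<delta> (d (Suc i)) (x i)) \<longlongrightarrow>
      (\<Sum>i<n. R (T r (x i) - T (d i) (x i)) - R (T r (x i) - T (d (Suc i)) (x i)))) (at_right 0)"
    unfolding J_def by (intro tendsto_sum_lcs tendsto_diff integ_ramp_tendsto d) auto
  also have "(\<Sum>i<n. R (T r (x i) - T (d i) (x i)) - R (T r (x i) - T (d (Suc i)) (x i))) = R (variation_sum d n x)"
    unfolding variation_sum_def R_simps(6) by (intro sum.cong refl) (simp add: R_simps)
  finally have lim: "((\<lambda>\<delta>. \<Sum>i<n. J \<delta> (d i) (x i) - J \<delta> (d (Suc i)) (x i)) \<longlongrightarrow> R (variation_sum d n x))
    (at_right 0)" .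
  have "convolution sc T (\<lambda>s. smoothed_step d n x \<delta> (r - s)) r =
      (\<Sum>i<n. J \<delta> (d i) (x i) - J \<delta> (d (Suc i)) (x i))" if \<delta>: "\<delta> > 0" for \<delta>
  proof -
    have "continuous_on {0..r} (\<lambda>u. ramp \<delta> (u - c) *\<^sub>r T u y)" for c y
      by (intro continuous_on_rscale continuous_on_orbit continuous_intros \<delta>) simp
    then have J: "has_integ 0 r (\<lambda>u. ramp \<delta> (u - c) *\<^sub>r T u y) (J \<delta> c y)" for c y
      unfolding J_def by (rule continuous_has_integ)
    have "has_integ 0 r (\<lambda>u. \<Sum>i<n. ramp \<delta> (u - d i) *\<^sub>r T u (x i) - ramp \<delta> (u - d (Suc i)) *\<^sub>r T u (x i))
        (\<Sum>i<n. J \<delta> (d i) (x i) - J \<delta> (d (Suc i)) (x i))"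
      by (intro has_integ_sum has_integ_diff J)
    then have "has_integ 0 r (\<lambda>u. T u (smoothed_step d n x \<delta> u))
        (\<Sum>i<n. J \<delta> (d i) (x i) - J \<delta> (d (Suc i)) (x i))"
      by (rule has_riemann_integral_cong) (simp add: smoothed_step_def T_simps rscale_left_diff)
    moreover have "continuous_on {0..r} (\<lambda>s. smoothed_step d n x \<delta> (r - s))"
      by (rule continuous_on_compose2[OF continuous_on_smoothed_step[OF \<delta>, of UNIV]])
         (auto intro!: continuous_intros)
    ultimately show ?thesis
      using convolution_eq(3)[of r "\<lambda>s. smoothed_step d n x \<delta> (r - s)" r] r by (simp add: integ_eq)
  qed
  then have "\<forall>\<^sub>F \<delta> in at_right 0. (\<Sum>i<n. J \<delta> (d i) (x i) - J \<delta> (d (Suc i)) (x i)) =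
      convolution sc T (\<lambda>s. smoothed_step d n x \<delta> (r - s)) r"
    by (intro eventually_at_rightI[of 0 1]) auto
  with lim show ?thesis by (rule Lim_transform_eventually)
qed

text \<open>The quotient at \<open>R w\<close> is the mean of the orbit of \<open>w\<close> over
  [0, h], so it obeys the bound of the orbit for all small \<open>h\<close> at once.\<close>

lemma difference_quotient_le:
  assumes q: "q \<in> \<Gamma>"
  obtains p M where "p \<in> \<Gamma>" "M > 0"
    "\<And>h w. 0 < h \<Longrightarrow> h \<le> 1 \<Longrightarrow> q ((1 / h) *\<^sub>r (T h (R w) - R w)) \<le> M * p w"
proof -
  note sq = \<Gamma>_seminorm[OF q]
  obtain p M where p: "p \<in> \<Gamma>" "M > 0" "\<And>t x. t \<in> {0..1} \<Longrightarrow> q (T t x) \<le> M * p x"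
    using T_bounded[OF q] by metis
  have "q ((1 / h) *\<^sub>r (T h (R w) - R w)) \<le> M * p w" if h: "0 < h" "h \<le> 1" for h w
  proof -
    have "has_integ 0 h (\<lambda>s. T s w) (T h (R w) - R w)"
      using continuous_has_integ[OF continuous_on_orbit, of 0 h w] integ_orbit_0[of h w] h
      by (simp add: R_simps T_R)
    then have "q (T h (R w) - R w) \<le> M * p w * (h - 0)"
      by (rule has_integ_le) (use h p q in auto)
    then show ?thesis using h by (simp add: seminorm_rscale[OF sq] field_simps)
  qed
  then show ?thesis using that p by blast
qed

text \<open>
  The values \<open>A(T * g)(r)\<close> for continuous approximations \<open>g\<close> of a step function are bounded but
  need not be shown to converge: after applying \<open>(T(h) - 1) / h \<circ> A\<inverse>\<close> they do, because
  \<open>(T * g)(r)\<close> converges, and the bound is uniform in \<open>h\<close>.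
\<close>

theorem three_C_imp_bounded_semivariation:
  assumes three: "three_C_space sc \<Gamma> T r" and r: "r > 0"
    and dom: "\<And>f. continuous_on {0..r} f \<Longrightarrow> convolution sc T f r \<in> D"
  shows "bounded_semivariation \<Gamma> T r"
  unfolding bounded_semivariation_def
proof
  fix q assume q: "q \<in> \<Gamma>"
  obtain q' M where q': "q' \<in> \<Gamma>" "M > 0"
    and M: "\<And>h w. 0 < h \<Longrightarrow> h \<le> 1 \<Longrightarrow> q ((1 / h) *\<^sub>r (T h (R w) - R w)) \<le> M * q' w"
    using difference_quotient_le[OF q] by metis
  obtain p C where p: "p \<in> \<Gamma>" and C: "\<And>f. continuous_on {0..r} f \<Longrightarrow>
      (\<And>s. s \<in> {0..r} \<Longrightarrow> p (f s) \<le> 1) \<Longrightarrow> q' (A (convolution sc T f r)) \<le> C"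
    using three_C_bound[OF three r dom q'(1)] by metis
  have bound: "q (variation_sum d n x) \<le> M * C"
    if d: "d 0 = 0" "d n = r" "\<And>i. i < n \<Longrightarrow> d i < d (Suc i)" and x: "\<And>i. i < n \<Longrightarrow> p (x i) \<le> 1" for d n x
  proof -
    have d_mem: "d i \<in> {0..r}" if "i \<le> n" for i
    proof -
      have "d i \<le> d n"
        by (rule lift_Suc_mono_le_ivl[where N = "{..<n}"]) (use d(3) that in \<open>auto intro: less_imp_le\<close>)
      then show ?thesis using increasing_nonneg[OF d(1,3) that] d(2) by simp
    qed
    let ?\<Psi> = "\<lambda>\<delta>. convolution sc T (\<lambda>s. smoothed_step d n x \<delta> (r - s)) r"
    let ?v = "variation_sum d n x"
    have lim: "(?\<Psi> \<longlongrightarrow> R ?v) (at_right 0)"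
      by (rule convolution_smoothed_step_tendsto[OF r d_mem])
    have le: "q ((1 / h) *\<^sub>r (T h (?\<Psi> \<delta>) - ?\<Psi> \<delta>)) \<le> M * C" if "0 < h" "h \<le> 1" "\<delta> > 0" for h \<delta>
    proof -
      have cont: "continuous_on {0..r} (\<lambda>s. smoothed_step d n x \<delta> (r - s))"
        by (rule continuous_on_compose2[OF continuous_on_smoothed_step[OF that(3), of UNIV]])
           (auto intro!: continuous_intros)
      have "q' (A (?\<Psi> \<delta>)) \<le> C"
        by (rule C[OF cont], rule smoothed_step_le[OF that(3) \<Gamma>_seminorm[OF p]]) (use d(3) x in \<open>auto intro: less_imp_le\<close>)
      then have "M * q' (A (?\<Psi> \<delta>)) \<le> M * C" using q'(2) by simp
      \<comment> \<open>The estimate is used for w = A(?\<Psi> \<delta>), for which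
        \<open>R w\<close> is \<open>?\<Psi> \<delta>\<close> itself.\<close>
      then show ?thesis using M[OF that(1,2), of "A (?\<Psi> \<delta>)"] by (simp add: R_A dom[OF cont])
    qed
    have le': "q ((1 / h) *\<^sub>r (T h (R ?v) - R ?v)) \<le> M * C" if h: "0 < h" "h \<le> 1" for h
    \<comment> \<open>First \<delta> tends to 0 with \<open>h\<close> fixed, which is allowed
      because the difference quotient with fixed \<open>h\<close> is a continuous map.\<close>
    proof (rule tendsto_upperbound)
      show "((\<lambda>\<delta>. q ((1 / h) *\<^sub>r (T h (?\<Psi> \<delta>) - ?\<Psi> \<delta>))) \<longlongrightarrow> q ((1 / h) *\<^sub>r (T h (R ?v) - R ?v))) (at_right 0)"
        using h by (intro tendsto_seminorm[OF \<Gamma>_continuous[OF q]] tendsto_rscale tendsto_const tendsto_diff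
            continuous_linear_tendsto[OF T_continuous_linear] lim) auto
      show "\<forall>\<^sub>F \<delta> in at_right 0. q ((1 / h) *\<^sub>r (T h (?\<Psi> \<delta>) - ?\<Psi> \<delta>)) \<le> M * C"
        using le[OF h] by (intro eventually_at_rightI[of 0 1]) auto
    qed simp
    \<comment> \<open>Then \<open>h\<close> tends to 0: the quotients at \<open>R ?v\<close> tend to
      \<open>A (R ?v)\<close>, which is \<open>?v\<close>.\<close>
    have "((\<lambda>h. q ((1 / h) *\<^sub>r (T h (R ?v) - R ?v))) \<longlongrightarrow> q ?v) (at_right 0)"
      using tendsto_seminorm[OF \<Gamma>_continuous[OF q] generatorD[OF R_in_D, of ?v]] by simp
    then show ?thesis
      by (rule tendsto_upperbound) (use le' in \<open>auto intro!: eventually_at_rightI[of 0 1]\<close>)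
  qed
  have "semivariation q p T r \<le> ereal (M * C)"
    unfolding semivariation_def
  proof (intro Sup_least, clarify)
    fix n :: nat and d :: "nat \<Rightarrow> real" and x :: "nat \<Rightarrow> 'a"
    assume *: "d 0 = 0" "r = d n" "\<forall>i<n. d i < d (Suc i)" "\<forall>i\<in>{1..n}. p (x i) \<le> 1"
    have "(\<Sum>i=1..n. T (d i) (x i) - T (d (i - 1)) (x i)) = variation_sum d n (\<lambda>i. x (Suc i))"
      unfolding variation_sum_def One_nat_def sum.atLeast1_atMost_eq by simp
    then show "ereal (q (\<Sum>i=1..n. T (d i) (x i) - T (d (i - 1)) (x i))) \<le> ereal (M * C)"
      using bound[of d n "\<lambda>i. x (Suc i)"] * by auto
  qed
  then show "\<exists>p\<in>\<Gamma>. semivariation q p T r < \<infinity>" using p by (intro bexI[of _ p]) auto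
qed

end


subsection \<open>The extrapolation space\<close>

lemma (in lcs) tendsto_scale:
  assumes "(f \<longlongrightarrow> l) F"
  shows "((\<lambda>x. sc c (f x)) \<longlongrightarrow> sc c l) F"
proof (rule tendsto_\<Gamma>I_zero)
  fix p assume p: "p \<in> \<Gamma>"
  have "((\<lambda>x. norm c * p (f x - l)) \<longlongrightarrow> norm c * 0) F"
    by (intro tendsto_intros tendsto_\<Gamma>D[OF assms p])
  then show "((\<lambda>x. p (sc c (f x) - sc c l)) \<longlongrightarrow> 0) F"
    by (simp add: seminorm_scale[OF \<Gamma>_seminorm[OF p]] flip: scale_right_diff_distrib)
qed

text \<open>As \<open>a x\<close> may be 0, \<open>x\<close> is divided by an arbitrary
  \<open>s > a x\<close>, and \<open>s\<close> is then decreased towards \<open>a x\<close>.\<close>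

lemma (in lcs) seminorm_le_of_ball:
  assumes a: "seminorm sc a" and b: "seminorm sc b" and le: "\<And>x. a x \<le> 1 \<Longrightarrow> b x \<le> C"
  shows "b x \<le> C * a x"
proof -
  have "b x \<le> C * s" if s: "a x < s" for s
  proof -
    have "s > 0" using s seminorm_nonneg[OF a, of x] by simp
    then have "b ((1 / s) *\<^sub>r x) \<le> C" using s by (intro le) (simp add: seminorm_rscale[OF a])
    then show ?thesis using \<open>s > 0\<close> by (simp add: seminorm_rscale[OF b] field_simps)
  qed
  then have "b x \<le> z" if "C * a x < z" for z
  proof (cases "C = 0")
    case False
    have "0 \<le> C" using le[of 0] by (simp add: seminorm_zero[OF a] seminorm_zero[OF b])
    with False have "C > 0" by simp
    then show ?thesis using \<open>\<And>s. a x < s \<Longrightarrow> b x \<le> C * s\<close>[of "z / C"] that by (simp add: field_simps)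
  qed (use that \<open>\<And>s. a x < s \<Longrightarrow> b x \<le> C * s\<close>[of "a x + 1"] in simp)
  then show ?thesis by (rule dense_ge)
qed

lemma continuous_on_additive_bound:
  fixes L :: "'x::topological_group_add \<Rightarrow> _"
  assumes Z: "lcs sc2 \<Gamma>2"
    and diff: "\<And>x y. L (x - y) = L x - L y"
    and bound: "\<And>q e. q \<in> \<Gamma>2 \<Longrightarrow> e > 0 \<Longrightarrow> \<exists>U. open U \<and> 0 \<in> U \<and> (\<forall>x\<in>U. q (L x) < e)"
  shows "continuous_on UNIV L"
  unfolding continuous_on_def
proof (intro ballI lcs.tendsto_\<Gamma>I[OF Z])
  fix y :: 'x and q and e :: real assume "q \<in> \<Gamma>2" "e > 0"
  then obtain U where U: "open U" "0 \<in> U" "\<And>x. x \<in> U \<Longrightarrow> q (L x) < e" using bound by metis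
  have "((\<lambda>x. x - y) \<longlongrightarrow> y - y) (at y within UNIV)"
    by (intro tendsto_diff tendsto_ident_at tendsto_const)
  then have "\<forall>\<^sub>F x in at y within UNIV. x - y \<in> U" using U(1,2) by (simp add: tendsto_def)
  then show "\<forall>\<^sub>F x in at y within UNIV. q (L x - L y) < e"
    by eventually_elim (use U(3) diff in metis)
qed

lemma dense_continuous_eq:
  fixes f g :: "'x::topological_space \<Rightarrow> 'y::t2_space"
  assumes "closure (range j) = UNIV" "continuous_on UNIV f" "continuous_on UNIV g"
    "\<And>x. f (j x) = g (j x)"
  shows "f = g"
proof -
  have "closed {y. f y = g y}" by (rule closed_Collect_eq[OF assms(2,3)])
  then have "closure (range j) \<subseteq> {y. f y = g y}" by (intro closure_minimal) (auto simp: assms(4))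
  then show ?thesis using assms(1) by auto
qed

text \<open>The bound is continuity of \<open>g\<close> at 0 for the topology that \<open>j\<close>
  induces. By linearity, \<open>g\<close> is then Cauchy along all \<open>x\<close> with
  \<open>j x\<close> near a given point, and completeness of the target defines the extension
  there.\<close>

lemma dense_extension:
  fixes sc0 :: "'k::real_normed_field \<Rightarrow> 'x::ab_group_add \<Rightarrow> 'x"
  assumes Y: "lcs sc1 \<Gamma>1" and Z: "lcs sc2 \<Gamma>2"
    and j: "Vector_Spaces.linear sc0 sc1 j" and g: "Vector_Spaces.linear sc0 sc2 g"
    and dense: "closure (range j) = UNIV"
    and bound: "\<And>q e. q \<in> \<Gamma>2 \<Longrightarrow> e > 0 \<Longrightarrow> \<exists>U. open U \<and> 0 \<in> U \<and> (\<forall>x. j x \<in> U \<longrightarrow> q (g x) < e)"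
  obtains S where "continuous_linear sc1 sc2 S" "\<And>x. S (j x) = g x"
proof -
  interpret j: Vector_Spaces.linear sc0 sc1 j by (rule j)
  interpret g: Vector_Spaces.linear sc0 sc2 g by (rule g)
  \<comment> \<open>The trace on the original space of the neighbourhoods of \<open>y\<close>; it is
    a proper filter because the range of \<open>j\<close> is dense.\<close>
  define F where "F = (\<lambda>y. filtercomap j (nhds y))"
  have F_neq_bot: "F y \<noteq> bot" for y
    unfolding F_def
  proof (rule filtercomap_neq_bot)
    fix P assume "eventually P (nhds y)"
    then obtain W where W: "open W" "y \<in> W" "\<And>z. z \<in> W \<Longrightarrow> P z" by (auto simp: eventually_nhds)
    then have "W \<inter> range j \<noteq> {}" using open_Int_closure_eq_empty[OF W(1), of "range j"] dense by auto
    then show "\<exists>x. P (j x)" using W(3) by blast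
  qed
  have j_lim: "(j \<longlongrightarrow> y) (F y)" for y unfolding F_def by (rule filterlim_filtercomap)
  have "\<exists>l. (g \<longlongrightarrow> l) (F y)" for y
  proof -
    have "\<exists>P. eventually P (F y) \<and> (\<forall>u v. P u \<longrightarrow> P v \<longrightarrow> q (g u - g v) < e)"
      if qe: "q \<in> \<Gamma>2" "e > 0" for q e
    proof -
      obtain U where U: "open U" "0 \<in> U" "\<And>x. j x \<in> U \<Longrightarrow> q (g x) < e" using bound[OF qe] by blast
      have "((\<lambda>z. fst z - snd z) \<longlongrightarrow> y - y) (nhds y \<times>\<^sub>F nhds y)"
        by (intro tendsto_diff filterlim_fst filterlim_snd)
      then have "\<forall>\<^sub>F z in nhds y \<times>\<^sub>F nhds y. fst z - snd z \<in> U" using U(1,2) by (simp add: tendsto_def)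
      then obtain Q where Q: "eventually Q (nhds y)" "\<And>a b. Q a \<Longrightarrow> Q b \<Longrightarrow> a - b \<in> U"
        unfolding eventually_prod_same by auto
      have "q (g u - g v) < e" if "Q (j u)" "Q (j v)" for u v
        using U(3)[of "u - v"] Q(2)[OF that] by (simp add: j.diff g.diff)
      then show ?thesis
        using Q(1) unfolding F_def by (intro exI[of _ "\<lambda>x. Q (j x)"]) (auto intro: eventually_filtercomapI)
    qed
    then show ?thesis using lcs.tendsto_Cauchy[OF Z F_neq_bot] by metis
  qed
  then obtain S where S: "\<And>y. (g \<longlongrightarrow> S y) (F y)" by metis
  \<comment> \<open>Every approximation of \<open>y\<close> through \<open>j\<close> computes
    \<open>S y\<close>. Additivity follows along a product of two such filters.\<close>
  have S_lim: "((\<lambda>u. g (w u)) \<longlongrightarrow> S y) H" if "((\<lambda>u. j (w u)) \<longlongrightarrow> y) H" for w y and H :: "'i filter"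
  proof (rule filterlim_compose[OF S])
    show "filterlim w (F y) H" using that by (simp add: F_def filterlim_filtercomap_iff o_def)
  qed
  have S_j: "S (j x) = g x" for x
    using S_lim[of "\<lambda>_::nat. x" "j x" sequentially] LIMSEQ_unique tendsto_const by blast
  have S_add: "S (y + z) = S y + S z" for y z
  proof (rule tendsto_unique)
    let ?H = "F y \<times>\<^sub>F F z"
    show "?H \<noteq> bot" by (simp add: prod_filter_eq_bot F_neq_bot)
    show "((\<lambda>u. g (fst u + snd u)) \<longlongrightarrow> S y + S z) ?H"
      unfolding g.add by (intro tendsto_add filterlim_compose[OF S] filterlim_fst filterlim_snd)
    show "((\<lambda>u. g (fst u + snd u)) \<longlongrightarrow> S (y + z)) ?H"
      by (rule S_lim) (auto simp: j.add intro!: tendsto_add filterlim_compose[OF j_lim] filterlim_fst filterlim_snd)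
  qed
  have S_scale: "S (sc1 c y) = sc2 c (S y)" for c y
  proof (rule tendsto_unique[OF F_neq_bot[of y]])
    show "((\<lambda>x. g (sc0 c x)) \<longlongrightarrow> sc2 c (S y)) (F y)"
      unfolding g.scale by (rule lcs.tendsto_scale[OF Z S])
    show "((\<lambda>x. g (sc0 c x)) \<longlongrightarrow> S (sc1 c y)) (F y)"
      by (rule S_lim) (simp add: j.scale lcs.tendsto_scale[OF Y j_lim])
  qed
  have "continuous_on UNIV S"
  proof (rule continuous_on_additive_bound[OF Z])
    show "S (x - y) = S x - S y" for x y using S_add[of "x - y" y] by (simp add: algebra_simps)
    fix q and e :: real assume qe: "q \<in> \<Gamma>2" "e > 0"
    then have "e / 2 > 0" by simp
    from bound[OF qe(1) this] obtain U where
      U: "open U" "0 \<in> U" "\<And>x. j x \<in> U \<Longrightarrow> q (g x) < e / 2" by blast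
    \<comment> \<open>The strict inequality becomes weak in the limit, hence
      \<open>e / 2\<close>.\<close>
    have "q (S y) \<le> e / 2" if "y \<in> U" for y
    proof (rule tendsto_upperbound[OF _ _ F_neq_bot])
      show "((\<lambda>x. q (g x)) \<longlongrightarrow> q (S y)) (F y)"
        by (rule lcs.tendsto_seminorm[OF Z lcs.\<Gamma>_continuous[OF Z qe(1)] S])
      have "\<forall>\<^sub>F x in F y. j x \<in> U" using j_lim U(1) that by (auto simp: tendsto_def)
      then show "\<forall>\<^sub>F x in F y. q (g x) \<le> e / 2" by eventually_elim (use U(3) in \<open>auto intro: less_imp_le\<close>)
    qed
    then have "\<forall>y\<in>U. q (S y) < e" using qe(2) by force
    then show "\<exists>U. open U \<and> 0 \<in> U \<and> (\<forall>x\<in>U. q (S x) < e)" using U by blast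
  qed
  then have "continuous_linear sc1 sc2 S"
    using S_add S_scale j.vs2.vector_space_axioms g.vs2.vector_space_axioms
    unfolding continuous_linear_iff by blast
  then show ?thesis using that S_j by blast
qed

section \<open>The embedding j, the operator A_{-1} and its inverse\<close>

locale extrapolated = lcs_semigroup sc \<Gamma> T
  for sc :: "'k::real_normed_field \<Rightarrow>
      'a::{complete_uniform_space, uniform_topological_group_add, t2_space, ab_group_add} \<Rightarrow> 'a"
    and \<Gamma> T +
  fixes sc' :: "'k \<Rightarrow>
      'b::{complete_uniform_space, uniform_topological_group_add, t2_space, ab_group_add} \<Rightarrow> 'b"
    and j :: "'a \<Rightarrow> 'b"
  assumes ext: "extrapolation_space sc \<Gamma> T sc' j"
begin

text \<open>The extrapolation space is given by its topology alone; the set of all its continuous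
  seminorms serves as fundamental system.\<close>

definition \<Gamma>' :: "('b \<Rightarrow> real) set" where
  "\<Gamma>' = {p. seminorm sc' p \<and> continuous_on UNIV p}"

definition \<tau> :: "'a topology" where
  "\<tau> = seminorm_topology UNIV ((\<lambda>p x. p (R x)) ` \<Gamma>)"

lemma lcs': "lcs sc' \<Gamma>'"
proof -
  have "locally_convex_space sc'" using ext by (simp add: extrapolation_space_def)
  moreover have "\<exists>p\<in>\<Gamma>'. \<exists>C\<ge>0. \<forall>x. q x \<le> C * p x" if "q \<in> \<Gamma>'" for q
    using that by (intro bexI[of _ q] exI[of _ 1]) auto
  then have "fundamental_system sc' \<Gamma>'"
    unfolding fundamental_system_def by (auto simp: \<Gamma>'_def)
  ultimately show ?thesis
    by (auto simp: lcs_def lcs_axioms_def locally_convex_space_def)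
qed

lemma dense_j: "closure (range j) = UNIV"
  and linear_j: "Vector_Spaces.linear sc sc' j"
  and embedding_j: "embedding_map \<tau> euclidean j"
  using ext by (simp_all add: extrapolation_space_def \<tau>_def R_def)

lemma topspace_\<tau>: "topspace \<tau> = UNIV"
  by (simp add: \<tau>_def topspace_seminorm_topology)

lemma homeomorphic_j: "homeomorphic_map \<tau> (subtopology euclidean (range j)) j"
  using embedding_j by (simp add: embedding_map_def topspace_\<tau>)

lemma inj_j: "inj j"
  using homeomorphic_imp_injective_map[OF homeomorphic_j] by (simp add: topspace_\<tau>)

lemma seminorm_R: "p \<in> \<Gamma> \<Longrightarrow> seminorm sc (\<lambda>x. p (R x))"
  using \<Gamma>_seminorm unfolding seminorm_def by (simp add: R_simps)

text \<open>Continuity of \<open>j\<close> for \<open>\<tau>\<close>, expressed by seminorms: a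
  neighbourhood of 0 in \<open>\<tau>\<close> contains a ball of a single p(R x), and scaling gives
  the inequality.\<close>

lemma j_bound_R:
  assumes q: "q \<in> \<Gamma>'"
  obtains p C where "p \<in> \<Gamma>" "C \<ge> 0" "\<And>x. q (j x) \<le> C * p (R x)"
proof -
  interpret j: Vector_Spaces.linear sc sc' j by (rule linear_j)
  have sq: "seminorm sc' q" and cq: "continuous_on UNIV q" using q by (auto simp: \<Gamma>'_def)
  have qj: "seminorm sc (\<lambda>x. q (j x))"
    using sq unfolding seminorm_def by (simp add: j.add j.scale)
  have c1: "continuous_map \<tau> euclidean j"
    by (rule continuous_map_into_fulltopology[OF homeomorphic_imp_continuous_map[OF homeomorphic_j]])
  have c2: "openin euclidean {y. q y < 1}"
    by (rule open_openin[THEN iffD1, OF open_Collect_less[OF cq continuous_on_const]])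
  have "openin \<tau> {x. q (j x) < 1}"
    using openin_continuous_map_preimage[OF c1 c2] unfolding topspace_\<tau> by simp
  moreover have "0 \<in> {x. q (j x) < 1}" by (simp add: seminorm_zero[OF qj, simplified])
  ultimately obtain F e where F: "finite F" "F \<subseteq> (\<lambda>p x. p (R x)) ` \<Gamma>" "e > 0"
    "{y \<in> UNIV. \<forall>P\<in>F. P (y - 0) < e} \<subseteq> {x. q (j x) < 1}"
    unfolding openin_seminorm_topology \<tau>_def by blast
  obtain F0 where F0: "finite F0" "F0 \<subseteq> \<Gamma>" "F = (\<lambda>p x. p (R x)) ` F0"
    using finite_subset_image[OF F(1,2)] by blast
  obtain p C where p: "p \<in> \<Gamma>" "C \<ge> 0" "\<And>q x. q \<in> F0 \<Longrightarrow> q x \<le> C * p x"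
    using dominated_finite[of F0] F0 \<Gamma>_seminorm \<Gamma>_continuous by blast
  define \<eta> where "\<eta> = e / (C + 1)"
  have \<eta>: "\<eta> > 0" "\<eta> * C < e" using F(3) p(2) by (auto simp: \<eta>_def field_simps add_pos_nonneg)
  have "q (j x) \<le> 1 / \<eta>" if x: "p (R x) \<le> 1" for x
  proof -
    have "p' (R (\<eta> *\<^sub>r x)) < e" if "p' \<in> F0" for p'
    proof -
      have "p' (R x) \<le> C * p (R x)" by (rule p(3)[OF that])
      also have "\<dots> \<le> C * 1" by (intro mult_left_mono x p(2))
      finally have "\<eta> * p' (R x) \<le> \<eta> * C" using \<eta>(1) by simp
      moreover have "p' (R (\<eta> *\<^sub>r x)) = \<eta> * p' (R x)"
        using \<eta>(1) seminorm_rscale[OF \<Gamma>_seminorm[OF subsetD[OF F0(2) that]]] by (simp add: R_simps)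
      ultimately show ?thesis using \<eta>(2) by linarith
    qed
    then have "q (j (\<eta> *\<^sub>r x)) < 1" using F(4) F0(3) by auto
    then show ?thesis using \<eta>(1) seminorm_rscale[OF qj, of \<eta> x] by (simp add: field_simps)
  qed
  then have "q (j x) \<le> 1 / \<eta> * p (R x)" for x
    by (rule seminorm_le_of_ball[OF seminorm_R[OF p(1)] qj])
  then show ?thesis using that[of p "1 / \<eta>"] p(1) \<eta>(1) by simp
qed

text \<open>The opposite estimate, from openness of \<open>j\<close> onto its range. It is the
  hypothesis that lets \<open>dense_extension\<close> extend \<open>R\<close>.\<close>

lemma R_small_near_0:
  assumes p: "p \<in> \<Gamma>" and e: "e > 0"
  obtains U where "open U" "0 \<in> U" "\<And>x. j x \<in> U \<Longrightarrow> p (R x) < e"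
proof -
  interpret j: Vector_Spaces.linear sc sc' j by (rule linear_j)
  define W where "W = {x. p (R x) < e}"
  have "\<exists>F d. finite F \<and> F \<subseteq> (\<lambda>p x. p (R x)) ` \<Gamma> \<and> d > 0 \<and> {y \<in> UNIV. \<forall>P\<in>F. P (y - x) < d} \<subseteq> W"
    if "x \<in> W" for x
  proof (intro exI conjI)
    show "{y \<in> UNIV. \<forall>P\<in>{\<lambda>x. p (R x)}. P (y - x) < e - p (R x)} \<subseteq> W"
    proof clarify
      fix y assume "\<forall>P\<in>{\<lambda>x. p (R x)}. P (y - x) < e - p (R x)"
      then show "y \<in> W"
        using seminorm_triangle[OF seminorm_R[OF p], of "y - x" x] by (simp add: W_def)
    qed
  qed (use p that in \<open>auto simp: W_def\<close>)
  then have "openin \<tau> W" unfolding \<tau>_def openin_seminorm_topology by blast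
  then have "openin (subtopology euclidean (range j)) (j ` W)"
    using homeomorphic_imp_open_map[OF homeomorphic_j] by (simp add: open_map_def)
  then obtain U where U: "open U" "j ` W = range j \<inter> U" by (auto simp: openin_open)
  moreover have "0 \<in> W" using e by (simp add: W_def R_simps seminorm_zero[OF \<Gamma>_seminorm[OF p]])
  then have "0 \<in> U" using U(2) j.zero by (metis IntD2 imageI)
  moreover have "p (R x) < e" if "j x \<in> U" for x
  proof -
    have "j x \<in> j ` W" using that U(2) by blast
    then show ?thesis using inj_j by (auto simp: W_def inj_def)
  qed
  ultimately show ?thesis using that by blast
qed

text \<open>The embedding is continuous for the original topology as well, because \<open>R\<close>
  is continuous and so the seminorms p(R x) are.\<close>

lemma j_continuous_linear: "continuous_linear sc sc' j"
  unfolding continuous_linear_def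
proof
  interpret j: Vector_Spaces.linear sc sc' j by (rule linear_j)
  show "Vector_Spaces.linear sc sc' j" by (rule linear_j)
  show "continuous_on UNIV j"
  proof (rule continuous_on_additive_bound[OF lcs'])
    fix q and e :: real assume q: "q \<in> \<Gamma>'" and e: "e > 0"
    obtain p C where C: "p \<in> \<Gamma>" "C \<ge> 0" "\<And>x. q (j x) \<le> C * p (R x)" using j_bound_R[OF q] by metis
    have "continuous_on UNIV (\<lambda>x. C * p (R x))"
      using R_continuous_linear C(1) by (intro continuous_intros continuous_on_\<Gamma>_compose) (auto simp: continuous_linear_def)
    then have "open {x. C * p (R x) < e}" by (rule open_Collect_less[OF _ continuous_on_const])
    moreover have "0 \<in> {x. C * p (R x) < e}" using e by (simp add: R_simps seminorm_zero[OF \<Gamma>_seminorm[OF C(1)]])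
    moreover have "\<forall>x\<in>{x. C * p (R x) < e}. q (j x) < e" using C(3) by (auto intro: le_less_trans)
    ultimately show "\<exists>U. open U \<and> 0 \<in> U \<and> (\<forall>x\<in>U. q (j x) < e)" by blast
  qed (rule j.diff)
qed

lemmas j_simps = continuous_linear_simps[OF j_continuous_linear]

text \<open>The continuous extension of \<open>R\<close> along \<open>j\<close>; by
  \<open>R'_B\<close> below it is a left inverse of \<open>B\<close>.\<close>

definition R' :: "'b \<Rightarrow> 'a" where
  "R' = (SOME S. continuous_linear sc' sc S \<and> (\<forall>x. S (j x) = R x))"

lemma R'_continuous_linear: "continuous_linear sc' sc R'"
  and R'_j: "R' (j x) = R x"
proof -
  have "\<exists>S. continuous_linear sc' sc S \<and> (\<forall>x. S (j x) = R x)"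
    using dense_extension[OF lcs' lcs_axioms linear_j _ dense_j] R_continuous_linear R_small_near_0
    unfolding continuous_linear_def by metis
  from someI_ex[OF this] show "continuous_linear sc' sc R'" "R' (j x) = R x"
    unfolding R'_def by blast+
qed

definition quotient :: "real \<Rightarrow> 'a \<Rightarrow> 'a" where
  "quotient t x = (1 / t) *\<^sub>r (T t x - x)"

text \<open>After \<open>R\<close> the quotient is the mean of the orbit over [0, t], so it
  converges for every \<open>x\<close>, also outside \<open>D\<close>.\<close>

lemma R_quotient_tendsto: "((\<lambda>t. R (quotient t x)) \<longlongrightarrow> x) (at_right 0)"
proof (rule Lim_transform_eventually)
  show "((\<lambda>h. (1 / h) *\<^sub>r integ 0 (0 + h) (\<lambda>s. T s x)) \<longlongrightarrow> x) (at_right 0)"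
    using average_tendsto[OF T_orbit[of x]] by (simp add: T_0)
  show "\<forall>\<^sub>F h in at_right 0. (1 / h) *\<^sub>r integ 0 (0 + h) (\<lambda>s. T s x) = R (quotient h x)"
    by (intro eventually_at_rightI[of 0 1]) (simp_all add: quotient_def integ_orbit_0 R_simps(7))
qed

text \<open>This is A_{-1} on X, formed from T and \<open>j\<close> only, so that it is available
  for describing T_{-1}.\<close>

definition B :: "'a \<Rightarrow> 'b" where
  "B x = Lim (at_right 0) (\<lambda>t. j (quotient t x))"

text \<open>By \<open>j_bound_R\<close>, seminorms after \<open>j\<close> are controlled by
  seminorms after \<open>R\<close>. Convergence of R(quotient) therefore makes the embedded
  quotients Cauchy.\<close>

lemma B_tendsto: "((\<lambda>t. j (quotient t x)) \<longlongrightarrow> B x) (at_right 0)"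
proof -
  obtain l where l: "((\<lambda>t. j (quotient t x)) \<longlongrightarrow> l) (at_right 0)"
  proof (rule lcs.tendsto_Cauchy[OF lcs', of "at_right (0::real)" "\<lambda>t. j (quotient t x)"])
    fix q and e :: real assume q: "q \<in> \<Gamma>'" and e: "e > 0"
    obtain p C where C: "p \<in> \<Gamma>" "C \<ge> 0" "\<And>x. q (j x) \<le> C * p (R x)" using j_bound_R[OF q] by metis
    note sp = \<Gamma>_seminorm[OF C(1)]
    define \<eta> where "\<eta> = e / (2 * (C + 1))"
    have \<eta>: "\<eta> > 0" "C * (2 * \<eta>) < e" using e C(2) by (auto simp: \<eta>_def field_simps add_pos_nonneg)
    have "q (j (quotient u x) - j (quotient v x)) < e"
      if "p (R (quotient u x) - x) < \<eta>" "p (R (quotient v x) - x) < \<eta>" for u v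
    proof -
      have "q (j (quotient u x) - j (quotient v x)) \<le> C * p (R (quotient u x) - R (quotient v x))"
        using C(3)[of "quotient u x - quotient v x"] by (simp add: j_simps R_simps)
      also have "\<dots> \<le> C * (2 * \<eta>)"
        using seminorm_diff_triangle[OF sp, of "R (quotient u x)" "R (quotient v x)" x]
          seminorm_minus_commute[OF sp, of x "R (quotient v x)"] that
        by (intro mult_left_mono C(2)) simp
      finally show ?thesis using \<eta>(2) by simp
    qed
    then show "\<exists>P. eventually P (at_right 0) \<and>
        (\<forall>u v. P u \<longrightarrow> P v \<longrightarrow> q (j (quotient u x) - j (quotient v x)) < e)"
      using tendsto_\<Gamma>D_less[OF R_quotient_tendsto C(1) \<eta>(1)] by blast
  qed simp
  then have "B x = l" unfolding B_def by (intro tendsto_Lim) simp_all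
  then show ?thesis using l by simp
qed

lemma B_eqI: "((\<lambda>t. j (quotient t x)) \<longlongrightarrow> l) (at_right 0) \<Longrightarrow> B x = l"
  using tendsto_unique[OF _ B_tendsto] by (metis trivial_limit_at_right_real)

lemma B_continuous_linear: "continuous_linear sc sc' B"
proof -
  have add: "B (x + y) = B x + B y" for x y
  proof (rule B_eqI, rule Lim_transform_eventually[OF tendsto_add[OF B_tendsto B_tendsto]])
    have "quotient t (x + y) = quotient t x + quotient t y" if "t > 0" for t
      using that by (simp add: quotient_def T_simps rscale_right_distrib rscale_right_diff)
    then show "\<forall>\<^sub>F t in at_right 0. j (quotient t x) + j (quotient t y) = j (quotient t (x + y))"
      by (intro eventually_at_rightI[of 0 1]) (simp_all add: j_simps)
  qed
  have scale: "B (sc c x) = sc' c (B x)" for c x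
  proof (rule B_eqI, rule Lim_transform_eventually[OF lcs.tendsto_scale[OF lcs' B_tendsto]])
    show "\<forall>\<^sub>F t in at_right 0. sc' c (j (quotient t x)) = j (quotient t (sc c x))"
      by (intro eventually_at_rightI[of 0 1])
         (simp_all add: quotient_def T_simps sc_rscale scale_right_diff_distrib flip: j_simps(5))
  qed
  have "continuous_on UNIV B"
  proof (rule continuous_on_additive_bound[OF lcs'])
    show "B (x - y) = B x - B y" for x y using add[of "x - y" y] by (simp add: algebra_simps)
    fix q and e :: real assume q: "q \<in> \<Gamma>'" and e: "e > 0"
    obtain p C where C: "p \<in> \<Gamma>" "C \<ge> 0" "\<And>x. q (j x) \<le> C * p (R x)" using j_bound_R[OF q] by metis
    \<comment> \<open>The bound of \<open>j\<close> by \<open>R\<close> applied to the quotients; in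
      the limit \<open>R\<close> cancels.\<close>
    have B_le: "q (B x) \<le> C * p x" for x
    proof (rule tendsto_le)
      show "((\<lambda>t. q (j (quotient t x))) \<longlongrightarrow> q (B x)) (at_right 0)"
        using q by (intro lcs.tendsto_seminorm[OF lcs' _ B_tendsto]) (simp add: \<Gamma>'_def)
      show "((\<lambda>t. C * p (R (quotient t x))) \<longlongrightarrow> C * p x) (at_right 0)"
        by (intro tendsto_intros tendsto_seminorm[OF \<Gamma>_continuous[OF C(1)] R_quotient_tendsto])
    qed (use C(3) in simp_all)
    have "open {x. C * p x < e}"
      by (intro open_Collect_less continuous_intros \<Gamma>_continuous C(1))
    moreover have "0 \<in> {x. C * p x < e}" using e by (simp add: seminorm_zero[OF \<Gamma>_seminorm[OF C(1)]])
    moreover have "\<forall>x\<in>{x. C * p x < e}. q (B x) < e" using B_le by (auto intro: le_less_trans)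
    ultimately show "\<exists>U. open U \<and> 0 \<in> U \<and> (\<forall>x\<in>U. q (B x) < e)" by blast
  qed
  then show ?thesis
    using add scale j_continuous_linear unfolding continuous_linear_iff by blast
qed

lemma B_R: "B (R x) = j x"
proof (rule B_eqI)
  have "((\<lambda>t. quotient t (R x)) \<longlongrightarrow> x) (at_right 0)"
    using generatorD[OF R_in_D, of x] by (simp add: quotient_def)
  then show "((\<lambda>t. j (quotient t (R x))) \<longlongrightarrow> j x) (at_right 0)"
    by (rule continuous_linear_tendsto[OF j_continuous_linear])
qed

lemma R'_B: "R' (B x) = x"
proof (rule tendsto_unique[of "at_right (0::real)"])
  show "((\<lambda>t. R (quotient t x)) \<longlongrightarrow> R' (B x)) (at_right 0)"
    using continuous_linear_tendsto[OF R'_continuous_linear B_tendsto] by (simp add: R'_j)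
qed (simp_all add: R_quotient_tendsto)

text \<open>Every \<open>j z\<close> equals \<open>B (R z)\<close>, and \<open>B\<close> is
  injective since \<open>R'\<close> undoes it; so \<open>B x\<close> is in the range only if
  \<open>x\<close> is some \<open>R z\<close>.\<close>

lemma B_in_range_j: "B x \<in> range j \<longleftrightarrow> x \<in> D"
proof
  assume "B x \<in> range j"
  then obtain z where "B x = B (R z)" by (auto simp: B_R)
  then have "x = R z" by (metis R'_B)
  then show "x \<in> D" by simp
next
  assume "x \<in> D"
  then have "B x = j (A x)" using B_R[of "A x"] by (simp add: R_A)
  then show "B x \<in> range j" by simp
qed

text \<open>Conjugation by \<open>B\<close> gives a continuous linear map that extends
  \<open>T t\<close>, since \<open>R'\<close> extends \<open>R\<close> and \<open>R\<close> commutes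
  with \<open>T t\<close>. Density of the range of \<open>j\<close> makes it the only one.\<close>

lemma extrapolated_semigroup_eq:
  assumes t: "t \<ge> 0"
  shows "extrapolated_semigroup sc' j T t = (\<lambda>y. B (T t (R' y)))"
  unfolding extrapolated_semigroup_def
proof (rule the_equality)
  have "continuous_linear sc' sc' (\<lambda>y. B (T t (R' y)))"
    by (intro continuous_linear_compose[OF R'_continuous_linear]
        continuous_linear_compose[OF T_continuous_linear[OF t]] B_continuous_linear)
  then show *: "continuous_linear sc' sc' (\<lambda>y. B (T t (R' y))) \<and> (\<forall>x. B (T t (R' (j x))) = j (T t x))"
    by (simp add: R'_j T_R t B_R)
  fix S assume "continuous_linear sc' sc' S \<and> (\<forall>x. S (j x) = j (T t x))"
  then show "S = (\<lambda>y. B (T t (R' y)))"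
    using * by (intro dense_continuous_eq[OF dense_j]) (auto simp: continuous_linear_def)
qed

lemma extrapolated_generator_eq: "extrapolated_generator sc' j T x = B x"
  unfolding extrapolated_generator_def generator_def
proof (rule tendsto_Lim)
  have "j (quotient t x) = sc' (of_real (1 / t)) (extrapolated_semigroup sc' j T t (j x) - j x)" if "t > 0" for t
    using that by (simp add: extrapolated_semigroup_eq R'_j T_R B_R quotient_def rscale_def j_simps)
  then show "((\<lambda>t. sc' (of_real (1 / t)) (extrapolated_semigroup sc' j T t (j x) - j x)) \<longlongrightarrow> B x) (at_right 0)"
    by (intro Lim_transform_eventually[OF B_tendsto] eventually_at_rightI[of 0 1]) auto
qed simp

text \<open>As \<open>R'\<close> undoes \<open>B\<close>, the integrand is \<open>B\<close> applied
  to T(r - s) f(s), and the continuous linear \<open>B\<close> passes through the Riemann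
  integral.\<close>

lemma extrapolated_convolution_eq:
  assumes f: "continuous_on {0..r} f" and r: "r \<ge> 0"
  shows "convolution sc' (extrapolated_semigroup sc' j T) (\<lambda>s. B (f s)) r = B (convolution sc T f r)"
proof -
  have "has_integ 0 r (\<lambda>s. T (r - s) (f s)) (convolution sc T f r)"
    using continuous_has_integ[OF convolution_eq(1)[OF f, of r]] r by (simp add: convolution_def)
  from has_riemann_integral_image[OF this B_continuous_linear]
  have "has_riemann_integral sc' 0 r (\<lambda>s. extrapolated_semigroup sc' j T (r - s) (B (f s)))
      (B (convolution sc T f r))"
    by (rule has_riemann_integral_cong) (simp add: extrapolated_semigroup_eq R'_B)
  then show ?thesis
    unfolding convolution_def[of sc'] by (rule lcs.integ_eq[OF lcs'])
qed

theorem C_admissible_iff: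
  assumes "r \<ge> 0"
  shows "C_admissible sc' j T (extrapolated_generator sc' j T) r \<longleftrightarrow>
    (\<forall>f. continuous_on {0..r} f \<longrightarrow> convolution sc T f r \<in> D)"
  using assms unfolding C_admissible_def
  by (simp add: extrapolated_generator_eq extrapolated_convolution_eq B_in_range_j)

end

theorem corollary5p5:
  fixes sc :: "'k::real_normed_field \<Rightarrow>
          'a::{complete_uniform_space, uniform_topological_group_add, t2_space, ab_group_add} \<Rightarrow> 'a"
    and sc' :: "'k \<Rightarrow>
          'b::{complete_uniform_space, uniform_topological_group_add, t2_space, ab_group_add} \<Rightarrow> 'b"
    and \<Gamma> :: "('a \<Rightarrow> real) set"
    and T :: "real \<Rightarrow> 'a \<Rightarrow> 'a"
    and j :: "'a \<Rightarrow> 'b"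
    and r :: real
  assumes "r > 0"
    and "locally_convex_space sc"
    and "fundamental_system sc \<Gamma>"
    and "strongly_continuous_semigroup sc T"
    and "quasi_equicontinuous sc \<Gamma> T"
    and "0 \<in> resolvent_set sc (generator_domain sc T) (generator sc T)"
  shows "(bounded_semivariation \<Gamma> T r \<longrightarrow> C_maximal_regularity sc T r) \<and>
    (extrapolation_space sc \<Gamma> T sc' j \<longrightarrow>
       (C_maximal_regularity sc T r \<longrightarrow>
          C_admissible sc' j T (extrapolated_generator sc' j T) r) \<and>
       (three_C_space sc \<Gamma> T r \<longrightarrow>
          C_admissible sc' j T (extrapolated_generator sc' j T) r \<longrightarrow>
          bounded_semivariation \<Gamma> T r))"
proof -
  interpret lcs_semigroup sc \<Gamma> T
    using assms
    by (simp add: lcs_semigroup_def lcs_semigroup_axioms_def lcs_def lcs_axioms_def locally_convex_space_def)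
  show ?thesis
  proof (intro conjI impI)
    assume "bounded_semivariation \<Gamma> T r"
    then show "C_maximal_regularity sc T r"
      using bounded_semivariation_imp_maximal_regularity \<open>r > 0\<close> by blast
  next
    assume "extrapolation_space sc \<Gamma> T sc' j"
    then interpret extrapolated sc \<Gamma> T sc' j by unfold_locales
    assume "C_maximal_regularity sc T r"
    then show "C_admissible sc' j T (extrapolated_generator sc' j T) r"
      using \<open>r > 0\<close> by (simp add: C_admissible_iff C_maximal_regularity_def)
  next
    assume "extrapolation_space sc \<Gamma> T sc' j"
    then interpret extrapolated sc \<Gamma> T sc' j by unfold_locales
    assume "three_C_space sc \<Gamma> T r" "C_admissible sc' j T (extrapolated_generator sc' j T) r"
    then show "bounded_semivariation \<Gamma> T r"
      using three_C_imp_bounded_semivariation \<open>r > 0\<close> by (simp add: C_admissible_iff)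
  qed
qed

end
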